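(* Let $K$ be a field, let $A=K[a_1,\dots,a_m]$, let $R=P/I$ be a positive $A$-algebra, let $G=\{g_1,\dots,g_s\}$ be a system of generators of $I$, and let $\Gamma=(\gamma_1,\dots,\gamma_m)\in K^m$. Then the following claims hold true. (a) $\operatorname{Lin}_A(I)=\langle X\rangle_A\cap(I+\langle X\rangle^2)$. (b) $\operatorname{Lin}_A(I)=\langle\operatorname{Lin}_A(g_1),\dots,\operatorname{Lin}_A(g_s)\rangle_A$. (c) The map $\varepsilon_\Gamma$ induces an epimorphism of $K$-vector spaces $$\operatorname{Cot}_{\mathfrak{M}_{\Gamma_0}/I}(P/I)\twoheadrightarrow\langle X\rangle_K/\operatorname{Lin}_{\langle X\rangle}(I_\Gamma)\cong\operatorname{Cot}_{\langle X\rangle/I_\Gamma}(K[X]/I_\Gamma).$$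
   Context: $A=K[a_1,\dots,a_m]$ is a trivially graded polynomial ring over the field $K$, and $P=A[x_1,\dots,x_k]$ is graded by $\deg(a_i)=0$ and $\deg(x_j)=w_j$, with positive integers $w_j$; $W=(w_1,\dots,w_k)$, $X=\{x_1,\dots,x_k\}$, $K[X]=K[x_1,\dots,x_k]$. A positive $A$-algebra is a ring $R=P/I$ where $I$ is a $W$-homogeneous ideal of $P$ with $I\cap A=\{0\}$ (hence $I\subseteq\langle x_1,\dots,x_k\rangle$). For $f\in P$ written as $f=f_0+f_1x_1+\cdots+f_kx_k+g$ with $f_0,\dots,f_k\in A$ and $g\in\langle X\rangle^2$, the $A$-linear part of $f$ is $\operatorname{Lin}_A(f)=f_1x_1+\cdots+f_kx_k$; the $A$-linear part of $I$ is the $A$-module $\operatorname{Lin}_A(I)=\langle\operatorname{Lin}_A(f)\mid f\in I\rangle_A$. Here $\langle\cdots\rangle_A$ and $\langle\cdots\rangle_K$ denote the generated $A$-submodule and $K$-subspace, so $\langle X\rangle_A=Ax_1+\cdots+Ax_k$ and $\langle X\rangle_K=Kx_1+\cdots+Kx_k$, while $\langle X\rangle$ is the ideal generated by $X$. The map $\varepsilon_\Gamma:P\to K[X]$ is the $K$-algebra epimorphism with $a_i\mapsto\gamma_i$ and $x_j\mapsto x_j$, and $I_\Gamma=\varepsilon_\Gamma(I)$. $\operatorname{Lin}_{\langle X\rangle}(I_\Gamma)$ is the $K$-vector space generated by the homogeneous components of standard degree 1 of the elements of $I_\Gamma$. $\mathfrak{M}_{\Gamma_0}=\langle a_1-\gamma_1,\dots,a_m-\gamma_m,x_1,\dots,x_k\rangle\subseteq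 P$. For a ring $S$ with maximal ideal $\mathfrak{m}$, $\operatorname{Cot}_{\mathfrak m}(S)=\mathfrak{m}/\mathfrak{m}^2$. *)

theory Defs
  imports
    "HOL-Algebra.Algebraic_Closure_Type"
    "HOL-Algebra.Ideal_Product"
    "HOL-Library.Poly_Mapping"
begin

section \<open>Polynomial rings\<close>

text \<open>
  All polynomial rings are subrings of one ring of polynomials over the field in the
  indeterminates \<open>IndA i\<close> (for the \<open>a\<close>'s) and \<open>IndX j\<close> (for the \<open>x\<close>'s), indexed from \<open>0\<close>.
  Thus \<open>A\<close> and \<open>K[X]\<close> are literally subrings of \<open>P\<close>, and \<open>m\<close>, \<open>k\<close> are arbitrary naturals.
\<close>

datatype indet = IndA nat | IndX nat

type_synonym 'a mpol = "(indet \<Rightarrow>\<^sub>0 nat) \<Rightarrow>\<^sub>0 'a"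

definition mconst :: "'a::field \<Rightarrow> 'a mpol" where
  "mconst c = Poly_Mapping.single 0 c"

definition mvar :: "indet \<Rightarrow> 'a::field mpol" where
  "mvar v = Poly_Mapping.single (Poly_Mapping.single v 1) 1"

definition mpoly_ring :: "indet set \<Rightarrow> 'a::field mpol ring" where
  "mpoly_ring V = (ring_of_type_algebra :: 'a mpol ring)
     \<lparr>carrier := {p. \<forall>t\<in>Poly_Mapping.keys p. Poly_Mapping.keys t \<subseteq> V}\<rparr>"

definition ring_K :: "'a::field ring" where
  "ring_K = ring_of_type_algebra"

definition ring_A :: "nat \<Rightarrow> 'a::field mpol ring" where
  "ring_A m = mpoly_ring (IndA ` {..<m})"

definition ring_KX :: "nat \<Rightarrow> 'a::field mpol ring" where
  "ring_KX k = mpoly_ring (IndX ` {..<k})"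

definition ring_P :: "nat \<Rightarrow> nat \<Rightarrow> 'a::field mpol ring" where
  "ring_P m k = mpoly_ring (IndA ` {..<m} \<union> IndX ` {..<k})"

definition X_set :: "nat \<Rightarrow> 'a::field mpol set" where
  "X_set k = (\<lambda>j. mvar (IndX j)) ` {..<k}"

definition wdeg :: "(indet \<Rightarrow> nat) \<Rightarrow> (indet \<Rightarrow>\<^sub>0 nat) \<Rightarrow> nat" where
  "wdeg wt t = (\<Sum>v\<in>Poly_Mapping.keys t. Poly_Mapping.lookup t v * wt v)"

definition hom_component :: "(indet \<Rightarrow> nat) \<Rightarrow> nat \<Rightarrow> 'a::field mpol \<Rightarrow> 'a mpol" where
  "hom_component wt d p = Poly_Mapping.mapp (\<lambda>t c. if wdeg wt t = d then c else 0) p"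

definition W_weight :: "(nat \<Rightarrow> nat) \<Rightarrow> indet \<Rightarrow> nat" where
  "W_weight w v = (case v of IndA i \<Rightarrow> 0 | IndX j \<Rightarrow> w j)"

text \<open>
  The substitution homomorphism \<open>\<epsilon>\<^sub>\<Gamma>\<close> with \<open>a\<^sub>i \<mapsto> \<gamma> i\<close>, \<open>x\<^sub>j \<mapsto> x\<^sub>j\<close>.  On \<open>P\<close> it only depends on
  \<open>\<gamma> 0, \<dots>, \<gamma> (m - 1)\<close>.
\<close>

definition eps :: "(nat \<Rightarrow> 'a::field) \<Rightarrow> 'a mpol \<Rightarrow> 'a mpol" where
  "eps \<gamma> p = (\<Sum>t\<in>Poly_Mapping.keys p. mconst (Poly_Mapping.lookup p t) *
     (\<Prod>v\<in>Poly_Mapping.keys t.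
        (case v of IndA i \<Rightarrow> mconst (\<gamma> i) | IndX j \<Rightarrow> mvar (IndX j)) ^ Poly_Mapping.lookup t v))"


section \<open>Modules, quotient modules and cotangent spaces\<close>

text \<open>
  \<open>subset_module S \<iota> V\<close> is the subset \<open>V\<close> of the ring \<open>S\<close>, regarded as a module via the
  structure map \<open>\<iota>\<close> into \<open>S\<close>.  The components \<open>mult\<close> and \<open>one\<close> of a module record play no role.
\<close>

definition subset_module ::
    "('b, 'm) ring_scheme \<Rightarrow> ('r \<Rightarrow> 'b) \<Rightarrow> 'b set \<Rightarrow> ('r, 'b) Module.module" where
  "subset_module S \<iota> V =
     \<lparr>carrier = V, monoid.mult = (\<otimes>\<^bsub>S\<^esub>), one = \<one>\<^bsub>S\<^esub>, ring.zero = \<zero>\<^bsub>S\<^esub>, add = (\<oplus>\<^bsub>S\<^esub>),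
      Module.module.smult = (\<lambda>c x. \<iota> c \<otimes>\<^bsub>S\<^esub> x)\<rparr>"

definition gen_submodule ::
    "('r, 'm) ring_scheme \<Rightarrow> ('r, 'b, 'n) module_scheme \<Rightarrow> 'b set \<Rightarrow> 'b set" where
  "gen_submodule R M B = (\<lambda>N. submodule N R M) hull B"

definition quot_module ::
    "('r, 'b, 'n) module_scheme \<Rightarrow> 'b set \<Rightarrow> ('r, 'b set) Module.module" where
  "quot_module M N =
     \<lparr>carrier = a_rcosets\<^bsub>M\<^esub> N, monoid.mult = undefined, one = undefined, ring.zero = N,
      add = set_add M, Module.module.smult = (\<lambda>c Y. \<Union>y\<in>Y. N +>\<^bsub>M\<^esub> (c \<odot>\<^bsub>M\<^esub> y))\<rparr>"

definition module_hom_set ::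
    "('r, 'm) ring_scheme \<Rightarrow> ('r, 'b, 'n) module_scheme \<Rightarrow> ('r, 'c, 'l) module_scheme
       \<Rightarrow> ('b \<Rightarrow> 'c) set" where
  "module_hom_set R M N =
     {h \<in> carrier M \<rightarrow> carrier N.
        (\<forall>x\<in>carrier M. \<forall>y\<in>carrier M. h (x \<oplus>\<^bsub>M\<^esub> y) = h x \<oplus>\<^bsub>N\<^esub> h y) \<and>
        (\<forall>c\<in>carrier R. \<forall>x\<in>carrier M. h (c \<odot>\<^bsub>M\<^esub> x) = c \<odot>\<^bsub>N\<^esub> h x)}"

definition module_epi_set ::
    "('r, 'm) ring_scheme \<Rightarrow> ('r, 'b, 'n) module_scheme \<Rightarrow> ('r, 'c, 'l) module_scheme
       \<Rightarrow> ('b \<Rightarrow> 'c) set" where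
  "module_epi_set R M N = {h \<in> module_hom_set R M N. h ` carrier M = carrier N}"

definition module_iso_set ::
    "('r, 'm) ring_scheme \<Rightarrow> ('r, 'b, 'n) module_scheme \<Rightarrow> ('r, 'c, 'l) module_scheme
       \<Rightarrow> ('b \<Rightarrow> 'c) set" where
  "module_iso_set R M N = {h \<in> module_hom_set R M N. bij_betw h (carrier M) (carrier N)}"

text \<open>The cotangent space of \<open>S\<close> at \<open>\<mm>\<close> as a module over the domain of the structure map \<open>\<iota>\<close>.\<close>

definition Cot ::
    "('b, 'm) ring_scheme \<Rightarrow> ('r \<Rightarrow> 'b) \<Rightarrow> 'b set \<Rightarrow> ('r, 'b set) Module.module" where
  "Cot S \<iota> \<mm> = quot_module (subset_module S \<iota> \<mm>) (ideal_prod S \<mm> \<mm>)"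

text \<open>
  \<open>quot_const S I\<close> is the structure map of the \<open>K\<close>-algebra \<open>S Quot I\<close>, and \<open>quot_ideal S I J\<close> is
  \<open>J/I\<close> as a subset of \<open>S Quot I\<close>.
\<close>

definition quot_const :: "'a::field mpol ring \<Rightarrow> 'a mpol set \<Rightarrow> 'a \<Rightarrow> 'a mpol set" where
  "quot_const S I c = I +>\<^bsub>S\<^esub> mconst c"

definition quot_ideal :: "('b, 'm) ring_scheme \<Rightarrow> 'b set \<Rightarrow> 'b set \<Rightarrow> 'b set set" where
  "quot_ideal S I J = (\<lambda>f. I +>\<^bsub>S\<^esub> f) ` J"


section \<open>Positive algebras and linear parts\<close>

definition W_homogeneous :: "(nat \<Rightarrow> nat) \<Rightarrow> 'a::field mpol set \<Rightarrow> bool" where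
  "W_homogeneous w I \<longleftrightarrow> (\<forall>f\<in>I. \<forall>d. hom_component (W_weight w) d f \<in> I)"

text \<open>\<open>P/I\<close> is a positive \<open>A\<close>-algebra, where \<open>deg x\<^sub>j = w j\<close>.\<close>

definition positive_algebra ::
    "nat \<Rightarrow> nat \<Rightarrow> (nat \<Rightarrow> nat) \<Rightarrow> 'a::field mpol set \<Rightarrow> bool" where
  "positive_algebra m k w I \<longleftrightarrow>
     (\<forall>j<k. 0 < w j) \<and> ideal I (ring_P m k) \<and> W_homogeneous w I \<and>
     I \<inter> carrier (ring_A m) = {0}"

definition X_ideal :: "nat \<Rightarrow> nat \<Rightarrow> 'a::field mpol set" where
  "X_ideal m k = Idl\<^bsub>ring_P m k\<^esub> (X_set k)"

definition X_ideal_sq :: "nat \<Rightarrow> nat \<Rightarrow> 'a::field mpol set" where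
  "X_ideal_sq m k = ideal_prod (ring_P m k) (X_ideal m k) (X_ideal m k)"

definition A_span :: "nat \<Rightarrow> nat \<Rightarrow> 'a::field mpol set \<Rightarrow> 'a mpol set" where
  "A_span m k B =
     gen_submodule (ring_A m) (subset_module (ring_P m k) (\<lambda>c. c) (carrier (ring_P m k))) B"

definition K_span :: "nat \<Rightarrow> 'a::field mpol set \<Rightarrow> 'a mpol set" where
  "K_span k B =
     gen_submodule ring_K (subset_module (ring_KX k) mconst (carrier (ring_KX k))) B"

text \<open>The decomposition determines \<open>l\<close>, since \<open>P = A \<oplus> \<langle>X\<rangle>\<^sub>A \<oplus> \<langle>X\<rangle>\<^sup>2\<close>.\<close>

definition Lin_A :: "nat \<Rightarrow> nat \<Rightarrow> 'a::field mpol \<Rightarrow> 'a mpol" where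
  "Lin_A m k f = (THE l. \<exists>f0 c g.
     f0 \<in> carrier (ring_A m) \<and> (\<forall>j<k. c j \<in> carrier (ring_A m)) \<and> g \<in> X_ideal_sq m k \<and>
     f = f0 + (\<Sum>j<k. c j * mvar (IndX j)) + g \<and> l = (\<Sum>j<k. c j * mvar (IndX j)))"

definition Lin_A_ideal :: "nat \<Rightarrow> nat \<Rightarrow> 'a::field mpol set \<Rightarrow> 'a mpol set" where
  "Lin_A_ideal m k I = A_span m k (Lin_A m k ` I)"

text \<open>On \<open>K[X]\<close> the standard degree is the weighted degree with all weights equal to \<open>1\<close>.\<close>

definition Lin_X :: "nat \<Rightarrow> 'a::field mpol set \<Rightarrow> 'a mpol set" where
  "Lin_X k J = K_span k (hom_component (\<lambda>_. 1) 1 ` J)"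

definition M_Gamma0 :: "nat \<Rightarrow> nat \<Rightarrow> (nat \<Rightarrow> 'a::field) \<Rightarrow> 'a mpol set" where
  "M_Gamma0 m k \<gamma> =
     Idl\<^bsub>ring_P m k\<^esub> ((\<lambda>i. mvar (IndA i) - mconst (\<gamma> i)) ` {..<m} \<union> X_set k)"

end

theory Submission
  imports Defs
begin

text \<open>
  Everything is read off from the degree \<open>xdeg\<close> of a monomial in the \<open>x\<close>'s alone, where every
  \<open>x\<^sub>j\<close> counts \<open>1\<close> and every \<open>a\<^sub>i\<close> counts \<open>0\<close>.  The ideal \<open>\<langle>X\<rangle>\<close> consists of the polynomials all of
  whose monomials have \<open>xdeg \<ge> 1\<close>, the ideal \<open>\<langle>X\<rangle>\<^sup>2\<close> of those with \<open>xdeg \<ge> 2\<close>, the module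
  \<open>\<langle>X\<rangle>\<^sub>A\<close> of those with \<open>xdeg = 1\<close> throughout, and \<open>Lin\<^sub>A(f)\<close> is the component of \<open>f\<close> of degree \<open>1\<close>
  (\<open>X_ideal_eq\<close>, \<open>X_ideal_sq_eq\<close>, \<open>A_span_X_set\<close>, \<open>Lin_A_eq\<close>).  Positivity of the grading
  yields \<open>I \<subseteq> \<langle>X\<rangle>\<close>: as all weights are positive, the part of \<open>f \<in> I\<close> of weighted degree \<open>0\<close>
  lies in \<open>I \<inter> A = 0\<close>.

  (a) As the elements of \<open>I\<close> have no component in \<open>A\<close>, the difference \<open>f - Lin\<^sub>A(f)\<close> lies in
  \<open>\<langle>X\<rangle>\<^sup>2\<close> for every \<open>f \<in> I\<close>.  Hence the set of linear parts of elements of \<open>I\<close> is exactly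
  \<open>\<langle>X\<rangle>\<^sub>A \<inter> (I + \<langle>X\<rangle>\<^sup>2)\<close>, which is already an \<open>A\<close>-module.

  (b) For \<open>g \<in> \<langle>X\<rangle>\<close> one has \<open>Lin\<^sub>A(r g) = r\<^sub>0 Lin\<^sub>A(g)\<close>, where \<open>r\<^sub>0 \<in> A\<close> is the component of \<open>r\<close> of
  degree \<open>0\<close>.  So the elements of \<open>\<langle>X\<rangle>\<close> whose linear part lies in a given \<open>A\<close>-submodule form an
  ideal, and this ideal contains \<open>I\<close> as soon as it contains the generators.

  (c) For an ideal \<open>J\<close> contained in an ideal \<open>\<mm>\<close> of a ring \<open>S\<close>, two elements of \<open>\<mm>\<close> have the same
  class in the cotangent space of \<open>S/J\<close> at \<open>\<mm>/J\<close> iff they differ by an element of \<open>J + \<mm>\<^sup>2\<close>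
  (\<open>Cot_quot_eq_iff\<close>).  For \<open>S = K[X]\<close> and \<open>\<mm> = \<langle>X\<rangle>\<close>, every class is represented by a linear
  form, and by (a) applied to \<open>I\<^sub>\<Gamma>\<close> two linear forms represent the same class iff they differ by an
  element of \<open>Lin(I\<^sub>\<Gamma>)\<close>; this is the isomorphism.  Part (a) is applicable because \<open>K[X]\<close> is the ring
  \<open>P\<close> for \<open>m = 0\<close>, where \<open>A\<close> is the field of constants.  For the epimorphism, \<open>\<epsilon>\<^sub>\<Gamma>\<close> maps
  \<open>\<MM>\<^sub>\<Gamma>\<^sub>0\<close> onto \<open>\<langle>X\<rangle>\<close>, its square onto \<open>\<langle>X\<rangle>\<^sup>2\<close> and \<open>I\<close> onto \<open>I\<^sub>\<Gamma>\<close>, so that sending \<open>f\<close> to the class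
  of the linear part of \<open>\<epsilon>\<^sub>\<Gamma>(f)\<close> is well defined on classes and surjective.
\<close>

section \<open>Modules inside a ring and their quotients\<close>

lemma subset_module_simps [simp]:
  "carrier (subset_module S \<iota> V) = V"
  "\<zero>\<^bsub>subset_module S \<iota> V\<^esub> = \<zero>\<^bsub>S\<^esub>"
  "x \<oplus>\<^bsub>subset_module S \<iota> V\<^esub> y = x \<oplus>\<^bsub>S\<^esub> y"
  "c \<odot>\<^bsub>subset_module S \<iota> V\<^esub> x = \<iota> c \<otimes>\<^bsub>S\<^esub> x"
  "N +>\<^bsub>subset_module S \<iota> V\<^esub> x = N +>\<^bsub>S\<^esub> x"
  by (simp_all add: subset_module_def a_r_coset_def')

lemma module_subset_module:
  assumes "cring K" "cring S" "\<iota> \<in> ring_hom K S"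
  shows "module K (subset_module S \<iota> (carrier S))"
proof -
  interpret K: cring K by fact
  interpret S: cring S by fact
  note h = ring_hom_closed[OF assms(3)] ring_hom_mult[OF assms(3)]
    ring_hom_add[OF assms(3)] ring_hom_one[OF assms(3)]
  show ?thesis
  proof (rule moduleI)
    show "abelian_group (subset_module S \<iota> (carrier S))"
      by (rule abelian_groupI)
        (auto simp: S.a_ac intro!: bexI[of _ "\<ominus>\<^bsub>S\<^esub> _"] S.l_neg)
  qed (auto simp: h S.l_distr S.r_distr S.m_assoc K.cring_axioms)
qed

text \<open>
  Closure under negation is automatic because scalars contain \<open>-1\<close>.
\<close>

lemma submodule_iff_closed:
  assumes "cring K" "cring S" "\<iota> \<in> ring_hom K S"
  shows "submodule N K (subset_module S \<iota> (carrier S)) \<longleftrightarrow>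
    N \<subseteq> carrier S \<and> \<zero>\<^bsub>S\<^esub> \<in> N \<and> (\<forall>x\<in>N. \<forall>y\<in>N. x \<oplus>\<^bsub>S\<^esub> y \<in> N) \<and>
    (\<forall>c\<in>carrier K. \<forall>x\<in>N. \<iota> c \<otimes>\<^bsub>S\<^esub> x \<in> N)" (is "?L \<longleftrightarrow> ?R")
proof -
  interpret K: cring K by fact
  interpret S: cring S by fact
  interpret M: module K "subset_module S \<iota> (carrier S)"
    by (rule module_subset_module[OF assms])
  show ?thesis
  proof
    assume L: ?L
    show ?R
      using M.submoduleE[OF L] submodule.smult_closed[OF L]
        subgroup.one_closed[OF submodule.axioms(1)[OF L]] by auto
  next
    assume R: ?R
    show ?L
    proof (rule M.submoduleI)
      fix a assume a: "a \<in> N"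
      then have "a \<in> carrier S" using R by blast
      then have "\<ominus>\<^bsub>subset_module S \<iota> (carrier S)\<^esub> a =
          (\<ominus>\<^bsub>K\<^esub> \<one>\<^bsub>K\<^esub>) \<odot>\<^bsub>subset_module S \<iota> (carrier S)\<^esub> a"
        by (subst M.smult_l_minus) (simp_all add: ring_hom_one[OF assms(3)])
      then show "\<ominus>\<^bsub>subset_module S \<iota> (carrier S)\<^esub> a \<in> N"
        using R a by simp
    qed (use R in auto)
  qed
qed

lemma ideal_is_submodule:
  assumes "cring K" "cring S" "\<iota> \<in> ring_hom K S" "ideal J S"
  shows "submodule J K (subset_module S \<iota> (carrier S))"
proof -
  interpret ideal J S by fact
  show ?thesis
    unfolding submodule_iff_closed[OF assms(1-3)]
    using a_subset I_l_closed ring_hom_closed[OF assms(3)] by auto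
qed

lemma module_on_submodule:
  assumes "cring K" "cring S" "\<iota> \<in> ring_hom K S"
    and "submodule V K (subset_module S \<iota> (carrier S))"
  shows "module K (subset_module S \<iota> V)"
  using submodule.submodule_is_module[OF assms(4) module_subset_module[OF assms(1-3)]]
  by (simp add: subset_module_def)

lemma submodule_of_submodule:
  assumes "cring K" "cring S" "\<iota> \<in> ring_hom K S"
    and "submodule V K (subset_module S \<iota> (carrier S))"
    and "submodule N K (subset_module S \<iota> (carrier S))" and "N \<subseteq> V"
  shows "submodule N K (subset_module S \<iota> V)"
proof (rule module.module_incl_imp_submodule)
  show "module K (subset_module S \<iota> V)" by (rule module_on_submodule) fact+
  show "module K (subset_module S \<iota> V\<lparr>carrier := N\<rparr>)"
    using module_on_submodule[OF assms(1-3,5)] by (simp add: subset_module_def)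
qed (use assms(6) in simp)

lemma ideal_of_closed:
  assumes "cring S" "J \<subseteq> carrier S" "\<zero>\<^bsub>S\<^esub> \<in> J"
    and "\<And>x y. x \<in> J \<Longrightarrow> y \<in> J \<Longrightarrow> x \<oplus>\<^bsub>S\<^esub> y \<in> J"
    and "\<And>r x. r \<in> carrier S \<Longrightarrow> x \<in> J \<Longrightarrow> r \<otimes>\<^bsub>S\<^esub> x \<in> J"
  shows "ideal J S"
proof -
  interpret S: cring S by fact
  show ?thesis
  proof (rule idealI)
    show "subgroup J (add_monoid S)"
    proof (rule S.add.subgroupI)
      fix a assume a: "a \<in> J"
      moreover from this have "a \<in> carrier S" using assms(2) by blast
      then have "(\<ominus>\<^bsub>S\<^esub> \<one>\<^bsub>S\<^esub>) \<otimes>\<^bsub>S\<^esub> a = \<ominus>\<^bsub>S\<^esub> a"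
        by (simp add: S.l_minus)
      ultimately show "\<ominus>\<^bsub>S\<^esub> a \<in> J" using assms(5)[of "\<ominus>\<^bsub>S\<^esub> \<one>\<^bsub>S\<^esub>" a] a by simp
    qed (use assms in auto)
    fix a x assume "a \<in> J" "x \<in> carrier S"
    then show "x \<otimes>\<^bsub>S\<^esub> a \<in> J" "a \<otimes>\<^bsub>S\<^esub> x \<in> J"
      using assms(2,5) S.m_comm[of a x] by auto
  qed (rule S.ring_axioms)
qed

lemma gen_submodule_least:
  assumes "submodule N R M" "B \<subseteq> N"
  shows "gen_submodule R M B \<subseteq> N"
  unfolding gen_submodule_def by (rule hull_minimal[where S = "\<lambda>N. submodule N R M", OF assms(2,1)])

lemma gen_submodule_superset: "B \<subseteq> gen_submodule R M B"
  by (simp add: gen_submodule_def hull_subset)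

lemma gen_submodule_is_submodule:
  assumes "cring K" "cring S" "\<iota> \<in> ring_hom K S" and "B \<subseteq> carrier S"
  shows "submodule (gen_submodule K (subset_module S \<iota> (carrier S)) B)
    K (subset_module S \<iota> (carrier S))"
proof -
  interpret S: cring S by fact
  let ?M = "subset_module S \<iota> (carrier S)"
  have full: "submodule (carrier S) K ?M"
    by (rule ideal_is_submodule[OF assms(1-3) S.oneideal])
  have "gen_submodule K ?M B \<subseteq> carrier S"
    by (rule gen_submodule_least[OF full assms(4)])
  then show ?thesis
    unfolding submodule_iff_closed[OF assms(1-3)]
    unfolding gen_submodule_def hull_def submodule_iff_closed[OF assms(1-3)] by blast
qed

text \<open>
  The right-hand side avoids subtraction, whose meaning in the structures used below
  (modules on subsets, quotient rings) would have to be computed first.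
\<close>

lemma coset_eq_iff:
  assumes "abelian_group M" "subgroup N (add_monoid M)" "x \<in> carrier M" "y \<in> carrier M"
  shows "N +>\<^bsub>M\<^esub> x = N +>\<^bsub>M\<^esub> y \<longleftrightarrow> (\<exists>n\<in>N. x = n \<oplus>\<^bsub>M\<^esub> y)"
proof -
  interpret abelian_subgroup N M
    by (intro abelian_subgroupI3 additive_subgroupI assms)
  show ?thesis
  proof
    assume "N +>\<^bsub>M\<^esub> x = N +>\<^bsub>M\<^esub> y"
    then have "x \<in> N +>\<^bsub>M\<^esub> y" using a_rcos_self[OF assms(3)] by simp
    then show "\<exists>n\<in>N. x = n \<oplus>\<^bsub>M\<^esub> y" by (auto simp: a_r_coset_def')
  next
    assume "\<exists>n\<in>N. x = n \<oplus>\<^bsub>M\<^esub> y"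
    then have "x \<in> N +>\<^bsub>M\<^esub> y" by (auto simp: a_r_coset_def')
    then show "N +>\<^bsub>M\<^esub> x = N +>\<^bsub>M\<^esub> y"
      using abelian_group.a_repr_independence[OF assms(1) _ assms(4,2)] by simp
  qed
qed

text \<open>
  The scalar multiplication of \<open>quot_module\<close> is a union over all representatives of a coset;
  this union is a single coset because \<open>N\<close> is closed under scalars.
\<close>

lemma quot_module_epi:
  assumes "module R M" "submodule N R M"
  shows "(\<lambda>x. N +>\<^bsub>M\<^esub> x) \<in> module_epi_set R M (quot_module M N)"
proof -
  interpret module R M by fact
  have sg: "subgroup N (add_monoid M)" by (rule submodule.axioms(1)[OF assms(2)])
  interpret N: abelian_subgroup N M
    by (intro abelian_subgroupI3 additive_subgroupI sg M.abelian_group_axioms)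
  have smult: "(\<Union>y\<in>N +>\<^bsub>M\<^esub> x. N +>\<^bsub>M\<^esub> (c \<odot>\<^bsub>M\<^esub> y)) = N +>\<^bsub>M\<^esub> (c \<odot>\<^bsub>M\<^esub> x)"
    if c: "c \<in> carrier R" and x: "x \<in> carrier M" for c x
  proof -
    have "N +>\<^bsub>M\<^esub> (c \<odot>\<^bsub>M\<^esub> y) = N +>\<^bsub>M\<^esub> (c \<odot>\<^bsub>M\<^esub> x)" if y: "y \<in> N +>\<^bsub>M\<^esub> x" for y
    proof -
      obtain n where n: "n \<in> N" "y = n \<oplus>\<^bsub>M\<^esub> x" using y by (auto simp: a_r_coset_def')
      then have "c \<odot>\<^bsub>M\<^esub> y = c \<odot>\<^bsub>M\<^esub> n \<oplus>\<^bsub>M\<^esub> c \<odot>\<^bsub>M\<^esub> x"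
        using c x by (simp add: smult_r_distr)
      moreover have "c \<odot>\<^bsub>M\<^esub> n \<in> N" using submodule.smult_closed[OF assms(2) c n(1)] .
      ultimately show ?thesis
        using n c x by (subst coset_eq_iff[OF M.abelian_group_axioms sg]) auto
    qed
    moreover have "x \<in> N +>\<^bsub>M\<^esub> x" by (rule N.a_rcos_self[OF x])
    ultimately show ?thesis by blast
  qed
  show ?thesis
    unfolding module_epi_set_def module_hom_set_def quot_module_def
    by (auto simp: N.a_rcos_sum smult A_RCOSETS_def')
qed

lemma module_epi_set_comp:
  assumes "g \<in> module_epi_set R M N" "h \<in> module_epi_set R N Q"
  shows "(\<lambda>x. h (g x)) \<in> module_epi_set R M Q"
proof -
  have "(\<lambda>x. h (g x)) ` carrier M = h ` g ` carrier M" by (simp add: image_image)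
  then show ?thesis
    using assms unfolding module_epi_set_def module_hom_set_def by (simp add: Pi_iff)
qed

text \<open>
  The universal property of a quotient, stated for an arbitrary surjection \<open>g\<close> in place of the
  canonical projection so that it applies to projections composed from several steps.
\<close>

lemma epi_factor:
  assumes M: "module R M"
    and g: "g \<in> module_epi_set R M Q" and h: "h \<in> module_epi_set R M N"
    and ker: "\<And>x y. x \<in> carrier M \<Longrightarrow> y \<in> carrier M \<Longrightarrow> g x = g y \<Longrightarrow> h x = h y"
  obtains \<phi> where "\<phi> \<in> module_epi_set R Q N" "\<And>x. x \<in> carrier M \<Longrightarrow> \<phi> (g x) = h x"
proof -
  interpret module R M by fact
  define \<phi> where "\<phi> y = h (SOME x. x \<in> carrier M \<and> g x = y)" for y
  have \<phi>: "\<phi> (g x) = h x" if "x \<in> carrier M" for x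
  proof -
    have "(SOME z. z \<in> carrier M \<and> g z = g x) \<in> carrier M \<and>
        g (SOME z. z \<in> carrier M \<and> g z = g x) = g x"
      using that by (intro someI[of "\<lambda>z. z \<in> carrier M \<and> g z = g x"]) auto
    then show ?thesis unfolding \<phi>_def using ker that by blast
  qed
  have Q: "carrier Q = g ` carrier M" and N: "carrier N = h ` carrier M"
    and g_hom: "\<And>x y. x \<in> carrier M \<Longrightarrow> y \<in> carrier M \<Longrightarrow> g x \<oplus>\<^bsub>Q\<^esub> g y = g (x \<oplus>\<^bsub>M\<^esub> y)"
      "\<And>c x. c \<in> carrier R \<Longrightarrow> x \<in> carrier M \<Longrightarrow> c \<odot>\<^bsub>Q\<^esub> g x = g (c \<odot>\<^bsub>M\<^esub> x)"
    and h_hom: "\<And>x y. x \<in> carrier M \<Longrightarrow> y \<in> carrier M \<Longrightarrow> h (x \<oplus>\<^bsub>M\<^esub> y) = h x \<oplus>\<^bsub>N\<^esub> h y"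
      "\<And>c x. c \<in> carrier R \<Longrightarrow> x \<in> carrier M \<Longrightarrow> h (c \<odot>\<^bsub>M\<^esub> x) = c \<odot>\<^bsub>N\<^esub> h x"
    using g h by (auto simp: module_epi_set_def module_hom_set_def)
  have "\<phi> \<in> module_epi_set R Q N"
    unfolding module_epi_set_def module_hom_set_def Q N
    by (auto simp: g_hom h_hom \<phi> image_image)
  then show ?thesis using \<phi> that by blast
qed

lemma epi_factor_iso:
  assumes M: "module R M"
    and g: "g \<in> module_epi_set R M Q" and h: "h \<in> module_epi_set R M N"
    and ker: "\<And>x y. x \<in> carrier M \<Longrightarrow> y \<in> carrier M \<Longrightarrow> g x = g y \<longleftrightarrow> h x = h y"
  obtains \<phi> where "\<phi> \<in> module_iso_set R Q N" "\<And>x. x \<in> carrier M \<Longrightarrow> \<phi> (g x) = h x"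
proof -
  obtain \<phi> where \<phi>: "\<phi> \<in> module_epi_set R Q N" "\<And>x. x \<in> carrier M \<Longrightarrow> \<phi> (g x) = h x"
    using epi_factor[OF M g h] ker by metis
  have "inj_on \<phi> (carrier Q)"
  proof (rule inj_onI)
    fix x y assume "x \<in> carrier Q" "y \<in> carrier Q" and eq: "\<phi> x = \<phi> y"
    moreover have "carrier Q = g ` carrier M" using g by (simp add: module_epi_set_def)
    ultimately obtain a b where ab: "a \<in> carrier M" "b \<in> carrier M" "x = g a" "y = g b"
      by blast
    then show "x = y" using eq \<phi>(2) ker by simp
  qed
  then have "\<phi> \<in> module_iso_set R Q N"
    using \<phi>(1) by (auto simp: module_epi_set_def module_iso_set_def bij_betw_def)
  then show ?thesis using \<phi>(2) that by blast
qed

lemma ideal_prod_hom_image: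
  assumes "ring S" "h \<in> ring_hom S R" "J \<subseteq> carrier S"
  shows "ideal_prod R (h ` J) (h ` J) = h ` ideal_prod S J J"
proof -
  interpret ring S by fact
  have sub: "x \<in> carrier S" if "x \<in> ideal_prod S J J" for x
    using that by induct (use assms(3) in auto)
  have hom: "h (i \<otimes>\<^bsub>S\<^esub> j) = h i \<otimes>\<^bsub>R\<^esub> h j" if "i \<in> J" "j \<in> J" for i j
    using ring_hom_mult[OF assms(2)] assms(3) that by blast
  have hom': "h (i \<oplus>\<^bsub>S\<^esub> j) = h i \<oplus>\<^bsub>R\<^esub> h j"
    if "i \<in> ideal_prod S J J" "j \<in> ideal_prod S J J" for i j
    using ring_hom_add[OF assms(2)] sub that by blast
  show ?thesis
  proof (intro equalityI subsetI)
    fix x assume "x \<in> ideal_prod R (h ` J) (h ` J)"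
    then show "x \<in> h ` ideal_prod S J J"
    proof induct
      case (prod a b)
      then obtain i j where "i \<in> J" "j \<in> J" "a = h i" "b = h j" by blast
      moreover from this have "a \<otimes>\<^bsub>R\<^esub> b = h (i \<otimes>\<^bsub>S\<^esub> j)" by (simp add: hom)
      ultimately show ?case by (auto intro: ideal_prod.prod)
    next
      case (sum a b)
      then obtain i j where "i \<in> ideal_prod S J J" "j \<in> ideal_prod S J J" "a = h i" "b = h j"
        by blast
      moreover from this have "a \<oplus>\<^bsub>R\<^esub> b = h (i \<oplus>\<^bsub>S\<^esub> j)" by (simp add: hom')
      ultimately show ?case by (auto intro: ideal_prod.sum)
    qed
  next
    fix y assume "y \<in> h ` ideal_prod S J J"
    then obtain x where x: "x \<in> ideal_prod S J J" "y = h x" by blast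
    from x(1) have "h x \<in> ideal_prod R (h ` J) (h ` J)"
    proof induct
      case (prod a b)
      then have "h (a \<otimes>\<^bsub>S\<^esub> b) = h a \<otimes>\<^bsub>R\<^esub> h b" by (simp add: hom)
      then show ?case using prod by (auto intro: ideal_prod.prod)
    next
      case (sum a b)
      then have "h (a \<oplus>\<^bsub>S\<^esub> b) = h a \<oplus>\<^bsub>R\<^esub> h b" by (simp add: hom')
      then show ?case using sum by (auto intro: ideal_prod.sum)
    qed
    then show "y \<in> ideal_prod R (h ` J) (h ` J)" using x by simp
  qed
qed

lemma ideal_hom_image:
  assumes "ring R" "h \<in> ring_hom S R" "h ` carrier S = carrier R" "ideal J S"
  shows "ideal (h ` J) R"
proof -
  interpret J: ideal J S by fact
  interpret h: ring_hom_ring S R h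
    by (intro ring_hom_ringI2 J.ring_axioms assms)
  show ?thesis
  proof (rule idealI)
    show "subgroup (h ` J) (add_monoid R)"
      by (rule h.img_is_add_subgroup[OF J.a_subgroup])
  next
    fix a x assume "a \<in> h ` J" "x \<in> carrier R"
    then obtain i r where ir: "i \<in> J" "r \<in> carrier S" "a = h i" "x = h r"
      using assms(3) by blast
    have "x \<otimes>\<^bsub>R\<^esub> a = h (r \<otimes>\<^bsub>S\<^esub> i)" "a \<otimes>\<^bsub>R\<^esub> x = h (i \<otimes>\<^bsub>S\<^esub> r)" using ir by simp_all
    moreover have "r \<otimes>\<^bsub>S\<^esub> i \<in> J" "i \<otimes>\<^bsub>S\<^esub> r \<in> J"
      using J.I_l_closed J.I_r_closed ir by simp_all
    ultimately show "x \<otimes>\<^bsub>R\<^esub> a \<in> h ` J" "a \<otimes>\<^bsub>R\<^esub> x \<in> h ` J"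
      by simp_all
  qed (rule assms(1))
qed

text \<open>
  The projection \<open>\<pi>\<close> from \<open>J\<close> to the cotangent space is the composite of two quotient maps.  Its fibres
  are given by \<open>I + J\<^sup>2\<close> because the square of the image \<open>\<mm>\<close> of \<open>J\<close> is the image of \<open>J\<^sup>2\<close>.
\<close>

lemma Cot_quot:
  fixes K :: "('r, 'm) ring_scheme" and S :: "('b, 'n) ring_scheme"
  assumes K: "cring K" and S: "cring S" and \<iota>: "\<iota> \<in> ring_hom K S"
    and I: "ideal I S" and J: "ideal J S"
  defines "R \<equiv> S Quot I" and "\<mm> \<equiv> quot_ideal S I J"
  defines "\<pi> \<equiv> \<lambda>f. ideal_prod R \<mm> \<mm> +>\<^bsub>R\<^esub> (I +>\<^bsub>S\<^esub> f)"
  shows Cot_quot_epi: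
      "\<pi> \<in> module_epi_set K (subset_module S \<iota> J) (Cot R (\<lambda>c. I +>\<^bsub>S\<^esub> \<iota> c) \<mm>)"
    and Cot_quot_eq_iff:
      "\<And>f g. f \<in> J \<Longrightarrow> g \<in> J \<Longrightarrow>
        \<pi> f = \<pi> g \<longleftrightarrow> (\<exists>i\<in>I. \<exists>t\<in>ideal_prod S J J. f = i \<oplus>\<^bsub>S\<^esub> (t \<oplus>\<^bsub>S\<^esub> g))"
proof -
  interpret S: cring S by fact
  interpret I: ideal I S by fact
  interpret J: ideal J S by fact
  interpret R: cring R unfolding R_def by (rule I.quotient_is_cring[OF S])
  let ?q = "\<lambda>f. I +>\<^bsub>S\<^esub> f"
  have q: "?q \<in> ring_hom S R" unfolding R_def by (rule I.rcos_ring_hom)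
  have \<iota>': "(\<lambda>c. ?q (\<iota> c)) \<in> ring_hom K R"
    using ring_hom_trans[OF \<iota> q] by (simp add: comp_def)
  have \<mm>_ideal: "ideal \<mm> R"
    unfolding \<mm>_def quot_ideal_def R_def by (rule S.ring_ideal_imp_quot_ideal[OF I J])
  have sq_ideal: "ideal (ideal_prod R \<mm> \<mm>) R"
    by (rule R.ideal_prod_is_ideal[OF \<mm>_ideal \<mm>_ideal])
  note subm = ideal_is_submodule[OF K R.cring_axioms \<iota>']
  have sq_le: "ideal_prod R \<mm> \<mm> \<subseteq> \<mm>"
    using R.ideal_prod_inter[OF \<mm>_ideal \<mm>_ideal] by simp
  have sub: "x \<in> carrier S" if "x \<in> J" for x using that by simp
  have q_epi: "?q \<in> module_epi_set K (subset_module S \<iota> J)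
      (subset_module R (\<lambda>c. ?q (\<iota> c)) \<mm>)"
    unfolding module_epi_set_def module_hom_set_def \<mm>_def quot_ideal_def
    using sub ring_hom_add[OF q] ring_hom_mult[OF q] ring_hom_closed[OF \<iota>] by auto
  have quot: "(\<lambda>x. ideal_prod R \<mm> \<mm> +>\<^bsub>R\<^esub> x) \<in>
      module_epi_set K (subset_module R (\<lambda>c. ?q (\<iota> c)) \<mm>) (Cot R (\<lambda>c. ?q (\<iota> c)) \<mm>)"
    using quot_module_epi[OF
        module_on_submodule[OF K R.cring_axioms \<iota>' subm[OF \<mm>_ideal]]
        submodule_of_submodule[OF K R.cring_axioms \<iota>' subm[OF \<mm>_ideal] subm[OF sq_ideal] sq_le]]
    unfolding Cot_def by simp
  show "\<pi> \<in> module_epi_set K (subset_module S \<iota> J) (Cot R (\<lambda>c. ?q (\<iota> c)) \<mm>)"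
    unfolding \<pi>_def by (rule module_epi_set_comp[OF q_epi quot])
  fix f g assume fg: "f \<in> J" "g \<in> J"
  note fgS = sub[OF fg(1)] sub[OF fg(2)]
  have "\<pi> f = \<pi> g \<longleftrightarrow> (\<exists>n\<in>ideal_prod R \<mm> \<mm>. ?q f = n \<oplus>\<^bsub>R\<^esub> ?q g)"
    unfolding \<pi>_def using ring_hom_closed[OF q] fgS
    by (intro coset_eq_iff R.abelian_group_axioms additive_subgroup.a_subgroup
        ideal.axioms(1) sq_ideal) auto
  also have "ideal_prod R \<mm> \<mm> = ?q ` ideal_prod S J J"
    unfolding \<mm>_def quot_ideal_def
    by (rule ideal_prod_hom_image[OF S.ring_axioms q J.a_subset])
  also have "(\<exists>n\<in>?q ` ideal_prod S J J. ?q f = n \<oplus>\<^bsub>R\<^esub> ?q g) \<longleftrightarrow>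
      (\<exists>t\<in>ideal_prod S J J. ?q f = ?q (t \<oplus>\<^bsub>S\<^esub> g))"
  proof -
    have "?q (t \<oplus>\<^bsub>S\<^esub> g) = ?q t \<oplus>\<^bsub>R\<^esub> ?q g" if "t \<in> ideal_prod S J J" for t
      using that S.ideal_prod_in_carrier[OF J J] ring_hom_add[OF q] fgS(2) by blast
    then show ?thesis by simp
  qed
  also have "\<dots> \<longleftrightarrow> (\<exists>t\<in>ideal_prod S J J. \<exists>i\<in>I. f = i \<oplus>\<^bsub>S\<^esub> (t \<oplus>\<^bsub>S\<^esub> g))"
    using S.ideal_prod_in_carrier[OF J J] fgS
    by (intro bex_cong refl coset_eq_iff S.abelian_group_axioms I.a_subgroup) auto
  finally show "\<pi> f = \<pi> g \<longleftrightarrow> (\<exists>i\<in>I. \<exists>t\<in>ideal_prod S J J. f = i \<oplus>\<^bsub>S\<^esub> (t \<oplus>\<^bsub>S\<^esub> g))"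
    by blast
qed

section \<open>Subrings of the polynomial ring\<close>

lemma mpoly_ring_simps [simp]:
  "x \<oplus>\<^bsub>mpoly_ring V\<^esub> y = x + y" "x \<otimes>\<^bsub>mpoly_ring V\<^esub> y = x * y"
  "\<zero>\<^bsub>mpoly_ring V\<^esub> = 0" "\<one>\<^bsub>mpoly_ring V\<^esub> = 1"
  by (simp_all add: mpoly_ring_def ring_of_type_algebra_def)

lemma carrier_mpoly_ring:
  "p \<in> carrier (mpoly_ring V) \<longleftrightarrow> (\<forall>t\<in>Poly_Mapping.keys p. Poly_Mapping.keys t \<subseteq> V)"
  by (simp add: mpoly_ring_def)

lemma mpoly_ring_closed [simp]:
  "0 \<in> carrier (mpoly_ring V)" "1 \<in> carrier (mpoly_ring V)"
  "p \<in> carrier (mpoly_ring V) \<Longrightarrow> q \<in> carrier (mpoly_ring V) \<Longrightarrow> p + q \<in> carrier (mpoly_ring V)"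
  "p \<in> carrier (mpoly_ring V) \<Longrightarrow> q \<in> carrier (mpoly_ring V) \<Longrightarrow> p * q \<in> carrier (mpoly_ring V)"
  "p \<in> carrier (mpoly_ring V) \<Longrightarrow> - p \<in> carrier (mpoly_ring V)"
proof -
  have keys_PQ: "Poly_Mapping.keys (a + b) \<subseteq> V"
    if "Poly_Mapping.keys a \<subseteq> V" "Poly_Mapping.keys b \<subseteq> V" for a b :: "indet \<Rightarrow>\<^sub>0 nat"
    using keys_add[of a b] that by blast
  show "p * q \<in> carrier (mpoly_ring V)"
    if "p \<in> carrier (mpoly_ring V)" "q \<in> carrier (mpoly_ring V)"
    using that keys_mult[of p q] keys_PQ unfolding carrier_mpoly_ring by blast
  show "p + q \<in> carrier (mpoly_ring V)"
    if "p \<in> carrier (mpoly_ring V)" "q \<in> carrier (mpoly_ring V)"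
    using that keys_add[of p q] unfolding carrier_mpoly_ring by blast
qed (simp_all add: carrier_mpoly_ring in_keys_iff)

lemma mpoly_ring_single [simp]:
  "Poly_Mapping.keys t \<subseteq> V \<Longrightarrow> Poly_Mapping.single t c \<in> carrier (mpoly_ring V)"
  by (simp add: carrier_mpoly_ring)

lemma mpoly_ring_mconst [simp]: "mconst c \<in> carrier (mpoly_ring V)"
  by (simp add: mconst_def)

lemma mpoly_ring_mvar [simp]: "v \<in> V \<Longrightarrow> mvar v \<in> carrier (mpoly_ring V)"
  by (simp add: mvar_def)

lemma mpoly_ring_sum:
  "(\<And>i. i \<in> A \<Longrightarrow> f i \<in> carrier (mpoly_ring V)) \<Longrightarrow> sum f A \<in> carrier (mpoly_ring V)"
  by (induct A rule: infinite_finite_induct) auto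

lemma mpoly_ring_prod:
  "(\<And>i. i \<in> A \<Longrightarrow> f i \<in> carrier (mpoly_ring V)) \<Longrightarrow> prod f A \<in> carrier (mpoly_ring V)"
  by (induct A rule: infinite_finite_induct) auto

lemma mpoly_ring_power:
  "p \<in> carrier (mpoly_ring V) \<Longrightarrow> p ^ n \<in> carrier (mpoly_ring V)"
  by (induct n) auto

lemma cring_mpoly_ring: "cring (mpoly_ring V)"
proof (rule cringI)
  show "abelian_group (mpoly_ring V)"
  proof (rule abelian_groupI)
    show "\<exists>y\<in>carrier (mpoly_ring V). y \<oplus>\<^bsub>mpoly_ring V\<^esub> x = \<zero>\<^bsub>mpoly_ring V\<^esub>"
      if "x \<in> carrier (mpoly_ring V)" for x
      using that by (intro bexI[of _ "- x"]) simp_all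
  qed (simp_all add: algebra_simps)
  show "comm_monoid (mpoly_ring V)"
    by (rule comm_monoidI) (simp_all add: algebra_simps)
qed (simp add: algebra_simps)

lemma cring_ring_K: "cring (ring_K :: 'a::field ring)"
  unfolding ring_K_def by (rule cring_from_type_algebra)

lemma mconst_simps:
  "mconst (a + b) = mconst a + mconst b" "mconst (a * b) = mconst a * mconst b"
  "mconst 1 = 1" "mconst 0 = 0" "mconst c * Poly_Mapping.single t a = Poly_Mapping.single t (c * a)"
  unfolding mconst_def by (simp_all add: single_add mult_single)

lemma mconst_hom: "mconst \<in> ring_hom ring_K (mpoly_ring V)"
  by (rule ring_hom_memI)
    (simp_all add: mconst_simps ring_K_def ring_of_type_algebra_def)

lemma mpoly_ring_mono: "U \<subseteq> V \<Longrightarrow> carrier (mpoly_ring U) \<subseteq> carrier (mpoly_ring V)"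
  unfolding subset_iff carrier_mpoly_ring by blast

lemma mpoly_ring_inclusion_hom: "U \<subseteq> V \<Longrightarrow> (\<lambda>c. c) \<in> ring_hom (mpoly_ring U) (mpoly_ring V)"
  by (rule ring_hom_memI) (auto dest: mpoly_ring_mono)

lemma inclusion_A_P: "(\<lambda>c. c) \<in> ring_hom (ring_A m) (ring_P m k)"
  unfolding ring_A_def ring_P_def by (rule mpoly_ring_inclusion_hom) simp

lemmas cring_P = cring_mpoly_ring[of "IndA ` {..<m} \<union> IndX ` {..<k}", folded ring_P_def] for m k
lemmas cring_A = cring_mpoly_ring[of "IndA ` {..<m}", folded ring_A_def] for m
lemmas ring_P_simps [simp] =
  mpoly_ring_simps[where V = "IndA ` {..<m} \<union> IndX ` {..<k}", folded ring_P_def] for m k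
lemmas ring_P_closed [simp] =
  mpoly_ring_closed[where V = "IndA ` {..<m} \<union> IndX ` {..<k}", folded ring_P_def] for m k

text \<open>
  Taking \<open>m = 0\<close> makes all results on \<open>P\<close> available for \<open>K[X]\<close>.
\<close>

lemma ring_KX_eq: "ring_KX k = ring_P 0 k"
  by (simp add: ring_KX_def ring_P_def)

lemma mvar_X_in_P [simp]: "j < k \<Longrightarrow> mvar (IndX j) \<in> carrier (ring_P m k)"
  by (simp add: ring_P_def)

lemma X_set_in_P: "X_set k \<subseteq> carrier (ring_P m k)"
  by (auto simp: X_set_def)

lemma ring_A_le_P: "carrier (ring_A m) \<subseteq> carrier (ring_P m k)"
  by (simp add: ring_A_def ring_P_def mpoly_ring_mono)

section \<open>Degrees of monomials\<close>

lemma poly_mapping_eq_sum_single: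
  "p = (\<Sum>t\<in>Poly_Mapping.keys p. Poly_Mapping.single t (Poly_Mapping.lookup p t))"
proof (rule poly_mapping_eqI)
  fix s
  have "Poly_Mapping.lookup
      (\<Sum>t\<in>Poly_Mapping.keys p. Poly_Mapping.single t (Poly_Mapping.lookup p t)) s =
      (\<Sum>t\<in>Poly_Mapping.keys p. if t = s then Poly_Mapping.lookup p t else 0)"
    unfolding lookup_sum by (intro sum.cong refl) (simp add: lookup_single when_def)
  also have "\<dots> = Poly_Mapping.lookup p s"
    by (simp add: in_keys_iff)
  finally show "Poly_Mapping.lookup p s = Poly_Mapping.lookup
      (\<Sum>t\<in>Poly_Mapping.keys p. Poly_Mapping.single t (Poly_Mapping.lookup p t)) s" by simp
qed

text \<open>
  Additive properties need to be checked only on the monomials of the given polynomial.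
\<close>

lemma monomial_induct [case_names zero add monomial]:
  fixes p :: "'t \<Rightarrow>\<^sub>0 'b::comm_monoid_add"
  assumes "Q 0" "\<And>p q. Q p \<Longrightarrow> Q q \<Longrightarrow> Q (p + q)"
    and "\<And>t. t \<in> Poly_Mapping.keys p \<Longrightarrow> Q (Poly_Mapping.single t (Poly_Mapping.lookup p t))"
  shows "Q p"
proof -
  have "Q (\<Sum>t\<in>F. Poly_Mapping.single t (Poly_Mapping.lookup p t))"
    if "finite F" "F \<subseteq> Poly_Mapping.keys p" for F
    using that by (induct F rule: finite_induct) (use assms in auto)
  from this[OF finite_keys subset_refl] show ?thesis
    using poly_mapping_eq_sum_single[of p] by simp
qed

lemma wdeg_superset:
  assumes "finite F" "Poly_Mapping.keys t \<subseteq> F"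
  shows "wdeg wt t = (\<Sum>v\<in>F. Poly_Mapping.lookup t v * wt v)"
  unfolding wdeg_def
  by (rule sum.mono_neutral_left[OF assms]) (simp add: in_keys_iff)

lemma wdeg_add: "wdeg wt (s + t) = wdeg wt s + wdeg wt t"
proof -
  let ?F = "Poly_Mapping.keys s \<union> Poly_Mapping.keys t"
  show ?thesis
    using keys_add[of s t]
    by (simp add: wdeg_superset[of ?F] lookup_add sum.distrib algebra_simps)
qed

lemma wdeg_single [simp]: "wdeg wt (Poly_Mapping.single v n) = n * wt v"
  by (cases "n = 0") (simp_all add: wdeg_def)

lemma lookup_hom_component:
  "Poly_Mapping.lookup (hom_component wt d p) t =
    (if wdeg wt t = d then Poly_Mapping.lookup p t else 0)"
  by (simp add: hom_component_def lookup_mapp when_def in_keys_iff)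

lemma keys_hom_component:
  "Poly_Mapping.keys (hom_component wt d p) = {t \<in> Poly_Mapping.keys p. wdeg wt t = d}"
  by (auto simp: in_keys_iff lookup_hom_component split: if_splits)

lemma hom_component_cong:
  assumes "\<And>t. t \<in> Poly_Mapping.keys p \<Longrightarrow> wdeg wt t = d \<longleftrightarrow> wdeg wt' t = d"
  shows "hom_component wt d p = hom_component wt' d p"
proof (rule poly_mapping_eqI)
  fix t
  show "Poly_Mapping.lookup (hom_component wt d p) t = Poly_Mapping.lookup (hom_component wt' d p) t"
    unfolding lookup_hom_component
    using assms[of t] by (cases "t \<in> Poly_Mapping.keys p") (simp_all add: in_keys_iff)
qed

definition xdeg :: "(indet \<Rightarrow>\<^sub>0 nat) \<Rightarrow> nat" where
  "xdeg = wdeg (W_weight (\<lambda>_. 1))"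

definition xpart :: "nat \<Rightarrow> 'a::field mpol \<Rightarrow> 'a mpol" where
  "xpart = hom_component (W_weight (\<lambda>_. 1))"

lemma xdeg_add: "xdeg (s + t) = xdeg s + xdeg t"
  by (simp add: xdeg_def wdeg_add)

lemma xdeg_single [simp]:
  "xdeg 0 = 0" "xdeg (Poly_Mapping.single (IndA i) n) = 0" "xdeg (Poly_Mapping.single (IndX j) n) = n"
  by (simp_all add: xdeg_def W_weight_def) (simp add: wdeg_def)

lemma xdeg_pos_iff: "0 < xdeg t \<longleftrightarrow> (\<exists>j. IndX j \<in> Poly_Mapping.keys t)"
proof -
  have "xdeg t = 0 \<longleftrightarrow> (\<forall>v\<in>Poly_Mapping.keys t. W_weight (\<lambda>_. 1) v = 0)"
    unfolding xdeg_def wdeg_def by (auto simp: in_keys_iff)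
  also have "\<dots> \<longleftrightarrow> (\<forall>j. IndX j \<notin> Poly_Mapping.keys t)"
    by (auto simp: W_weight_def split: indet.splits)
  finally show ?thesis by auto
qed

lemma xdeg_pos_split:
  assumes "0 < xdeg t"
  obtains j s where "IndX j \<in> Poly_Mapping.keys t" "t = s + Poly_Mapping.single (IndX j) 1"
    "Poly_Mapping.keys s \<subseteq> Poly_Mapping.keys t" "xdeg t = Suc (xdeg s)"
proof -
  obtain j where j: "IndX j \<in> Poly_Mapping.keys t" using assms xdeg_pos_iff by blast
  let ?s = "t - Poly_Mapping.single (IndX j) 1"
  have t: "t = ?s + Poly_Mapping.single (IndX j) 1"
    using j by (intro poly_mapping_eqI)
      (auto simp: lookup_add lookup_minus lookup_single when_def in_keys_iff)
  moreover have "Poly_Mapping.keys ?s \<subseteq> Poly_Mapping.keys t"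
    by (auto simp: in_keys_iff lookup_minus)
  moreover have "xdeg t = Suc (xdeg ?s)" by (subst t) (simp add: xdeg_add)
  ultimately show ?thesis using that j by blast
qed

lemma single_times_mvar:
  "Poly_Mapping.single (s + Poly_Mapping.single v 1) c = Poly_Mapping.single s c * mvar v"
  by (simp add: mvar_def mult_single)

lemma xpart_simps:
  "xpart d 0 = 0" "xpart d (p + q) = xpart d p + xpart d q"
  "xpart d (Poly_Mapping.single t c) = (if xdeg t = d then Poly_Mapping.single t c else 0)"
  by (auto intro!: poly_mapping_eqI simp: xpart_def xdeg_def lookup_hom_component lookup_add
      lookup_single when_def)

lemma keys_xpart: "Poly_Mapping.keys (xpart d p) = {t \<in> Poly_Mapping.keys p. xdeg t = d}"
  by (simp add: xpart_def xdeg_def keys_hom_component)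

lemma xpart_closed: "p \<in> carrier (mpoly_ring V) \<Longrightarrow> xpart d p \<in> carrier (mpoly_ring V)"
  by (auto simp: carrier_mpoly_ring keys_xpart)

lemma xpart_eq_self: "(\<And>t. t \<in> Poly_Mapping.keys p \<Longrightarrow> xdeg t = d) \<Longrightarrow> xpart d p = p"
  by (intro poly_mapping_eqI) (auto simp: xpart_def xdeg_def lookup_hom_component in_keys_iff)

lemma xpart_eq_0: "(\<And>t. t \<in> Poly_Mapping.keys p \<Longrightarrow> xdeg t \<noteq> d) \<Longrightarrow> xpart d p = 0"
  by (intro poly_mapping_eqI) (auto simp: xpart_def xdeg_def lookup_hom_component in_keys_iff)

text \<open>
  The product rule that makes linear parts \<open>A\<close>-linear modulo \<open>\<langle>X\<rangle>\<^sup>2\<close>: two factors have degrees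
  adding up to \<open>1\<close> only if one of them has degree \<open>0\<close>.
\<close>

lemma xpart_1_mult: "xpart 1 (p * q) = xpart 0 p * xpart 1 q + xpart 1 p * xpart 0 q"
proof (induct p rule: monomial_induct)
  case (monomial s)
  show ?case
  proof (induct q rule: monomial_induct)
    case (monomial t)
    show ?case by (auto simp: mult_single xpart_simps xdeg_add)
  qed (simp_all add: xpart_simps algebra_simps)
qed (simp_all add: xpart_simps algebra_simps)

section \<open>The filtration by the degree in the x's\<close>

definition xord_ge :: "nat \<Rightarrow> nat \<Rightarrow> nat \<Rightarrow> 'a::field mpol set" where
  "xord_ge m k n = {p \<in> carrier (ring_P m k). \<forall>t\<in>Poly_Mapping.keys p. n \<le> xdeg t}"

definition linear_forms :: "nat \<Rightarrow> nat \<Rightarrow> 'a::field mpol set" where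
  "linear_forms m k = {p \<in> carrier (ring_P m k). \<forall>t\<in>Poly_Mapping.keys p. xdeg t = 1}"

lemma xord_ge_mult:
  assumes "p \<in> xord_ge m k n" "q \<in> xord_ge m k n'"
  shows "p * q \<in> xord_ge m k (n + n')"
proof -
  have "n + n' \<le> xdeg t" if t: "t \<in> Poly_Mapping.keys (p * q)" for t
  proof -
    obtain a b where "a \<in> Poly_Mapping.keys p" "b \<in> Poly_Mapping.keys q" "t = a + b"
      using keys_mult[of p q] t by blast
    moreover from this have "n \<le> xdeg a" "n' \<le> xdeg b" using assms by (auto simp: xord_ge_def)
    ultimately show ?thesis by (simp add: xdeg_add)
  qed
  then show ?thesis using assms by (simp add: xord_ge_def)
qed

lemma xord_ge_ideal: "ideal (xord_ge m k n) (ring_P m k)"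
proof (rule ideal_of_closed[OF cring_P])
  show "x \<oplus>\<^bsub>ring_P m k\<^esub> y \<in> xord_ge m k n" if "x \<in> xord_ge m k n" "y \<in> xord_ge m k n" for x y
    using that keys_add[of x y] by (auto simp: xord_ge_def)
  show "r \<otimes>\<^bsub>ring_P m k\<^esub> x \<in> xord_ge m k n" if "r \<in> carrier (ring_P m k)" "x \<in> xord_ge m k n" for r x
    using xord_ge_mult[of r m k 0 x n] that by (simp add: xord_ge_def)
qed (auto simp: xord_ge_def)

lemma single_in_P:
  "p \<in> carrier (ring_P m k) \<Longrightarrow> t \<in> Poly_Mapping.keys p \<Longrightarrow> Poly_Mapping.keys s \<subseteq> Poly_Mapping.keys t \<Longrightarrow>
    Poly_Mapping.single s c \<in> carrier (ring_P m k)"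
  unfolding ring_P_def by (intro mpoly_ring_single) (auto simp: carrier_mpoly_ring)

lemma index_X_less:
  "p \<in> carrier (ring_P m k) \<Longrightarrow> t \<in> Poly_Mapping.keys p \<Longrightarrow> IndX j \<in> Poly_Mapping.keys t \<Longrightarrow> j < k"
  unfolding ring_P_def by (auto simp: carrier_mpoly_ring)

text \<open>
  A monomial of positive degree is divisible by some \<open>x\<^sub>j\<close>; splitting off one such factor shows
  that the polynomials of order at least \<open>1\<close> lie in the ideal generated by \<open>X\<close>.
\<close>

lemma X_ideal_eq: "X_ideal m k = (xord_ge m k 1 :: 'a::field mpol set)" (is "?X = ?F")
proof
  interpret P: cring "ring_P m k" by (rule cring_P)
  show "?X \<subseteq> ?F"
    unfolding X_ideal_def
    by (rule P.genideal_minimal[OF xord_ge_ideal])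
      (auto simp: X_set_def xord_ge_def, simp add: mvar_def)
  interpret X: ideal ?X "ring_P m k"
    unfolding X_ideal_def by (rule P.genideal_ideal[OF X_set_in_P])
  show "?F \<subseteq> ?X"
  proof
    fix p :: "'a mpol" assume p: "p \<in> ?F"
    then have pP: "p \<in> carrier (ring_P m k)" by (simp add: xord_ge_def)
    show "p \<in> X_ideal m k"
    proof (induct p rule: monomial_induct)
      case zero
      show ?case using X.zero_closed by simp
    next
      case (add p q)
      then show ?case using X.a_closed[of p q] by simp
    next
      case (monomial t)
      then have "0 < xdeg t" using p by (auto simp: xord_ge_def)
      then obtain j s where js: "IndX j \<in> Poly_Mapping.keys t"
        "t = s + Poly_Mapping.single (IndX j) 1" "Poly_Mapping.keys s \<subseteq> Poly_Mapping.keys t"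
        by (rule xdeg_pos_split)
      then have "mvar (IndX j) \<in> X_ideal m k"
        unfolding X_ideal_def using index_X_less[OF pP monomial]
        by (intro P.genideal_self[OF X_set_in_P, THEN subsetD]) (auto simp: X_set_def)
      from X.I_l_closed[OF this single_in_P[OF pP monomial js(3)]]
      show ?case unfolding js(2) single_times_mvar by simp
    qed
  qed
qed

lemma X_ideal_ideal: "ideal (X_ideal m k) (ring_P m k)"
  unfolding X_ideal_eq by (rule xord_ge_ideal)

lemma X_ideal_in_P: "f \<in> X_ideal m k \<Longrightarrow> f \<in> carrier (ring_P m k)"
  by (simp add: X_ideal_eq xord_ge_def)

text \<open>
  If a monomial has degree at least \<open>2\<close>, then what remains after splitting off one \<open>x\<^sub>j\<close> still
  lies in \<open>\<langle>X\<rangle>\<close>.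
\<close>

lemma X_ideal_sq_eq: "X_ideal_sq m k = (xord_ge m k 2 :: 'a::field mpol set)" (is "?Q = ?F")
proof
  interpret P: cring "ring_P m k" by (rule cring_P)
  have X: "ideal (X_ideal m k :: 'a mpol set) (ring_P m k)"
    unfolding X_ideal_eq by (rule xord_ge_ideal)
  interpret Q: ideal ?Q "ring_P m k"
    unfolding X_ideal_sq_def by (rule P.ideal_prod_is_ideal[OF X X])
  show "?Q \<subseteq> ?F"
  proof
    fix p :: "'a mpol" assume "p \<in> ?Q"
    then show "p \<in> xord_ge m k 2"
      unfolding X_ideal_sq_def
    proof induct
      case (prod i j)
      then show ?case using xord_ge_mult[of i m k 1 j 1] by (simp add: X_ideal_eq numeral_2_eq_2)
    next
      case (sum s1 s2)
      show ?case 
        by (rule additive_subgroup.a_closed[OF ideal.axioms(1)[OF xord_ge_ideal] sum(2,4)])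
    qed
  qed
  show "?F \<subseteq> ?Q"
  proof
    fix p :: "'a mpol" assume p: "p \<in> ?F"
    then have pP: "p \<in> carrier (ring_P m k)" by (simp add: xord_ge_def)
    show "p \<in> X_ideal_sq m k"
    proof (induct p rule: monomial_induct)
      case zero
      show ?case using Q.zero_closed by simp
    next
      case (add p q)
      then show ?case using Q.a_closed[of p q] by simp
    next
      case (monomial t)
      then have t: "2 \<le> xdeg t" using p by (auto simp: xord_ge_def)
      then have "0 < xdeg t" by simp
      then obtain j s where js: "IndX j \<in> Poly_Mapping.keys t"
        "t = s + Poly_Mapping.single (IndX j) 1" "Poly_Mapping.keys s \<subseteq> Poly_Mapping.keys t"
        "xdeg t = Suc (xdeg s)"
        by (rule xdeg_pos_split)
      have "Poly_Mapping.single s (Poly_Mapping.lookup p t) \<in> X_ideal m k"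
        using single_in_P[OF pP monomial js(3)] t js(4) by (auto simp: X_ideal_eq xord_ge_def)
      moreover have "mvar (IndX j) \<in> X_ideal m k"
        using index_X_less[OF pP monomial js(1)]
        by (simp add: X_ideal_eq xord_ge_def) (simp add: mvar_def)
      ultimately show ?case
        unfolding js(2) single_times_mvar X_ideal_sq_def
        using ideal_prod.prod[of _ "X_ideal m k" _ "X_ideal m k" "ring_P m k"] by simp
    qed
  qed
qed

lemma xpart_0_X_ideal: "f \<in> X_ideal m k \<Longrightarrow> xpart 0 f = 0"
  by (rule xpart_eq_0) (auto simp: X_ideal_eq xord_ge_def)

lemma xpart_1_X_ideal_sq: "f \<in> X_ideal_sq m k \<Longrightarrow> xpart 1 f = 0"
  by (rule xpart_eq_0) (auto simp: X_ideal_sq_eq xord_ge_def)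

lemma lincomb_in_linear_forms:
  assumes "\<And>j. j < k \<Longrightarrow> c j \<in> carrier (ring_A m)"
  shows "(\<Sum>j<k. c j * mvar (IndX j)) \<in> linear_forms m k"
proof -
  have *: "c j * mvar (IndX j) \<in> carrier (ring_P m k)" if "j < k" for j
    using assms[OF that] ring_A_le_P mvar_X_in_P[OF that] by (intro ring_P_closed) auto
  have "Poly_Mapping.keys (c j * mvar (IndX j)) \<subseteq> {t. xdeg t = 1}" if "j < k" for j
  proof
    fix t assume "t \<in> Poly_Mapping.keys (c j * mvar (IndX j))"
    then obtain s where s: "s \<in> Poly_Mapping.keys (c j)" "t = s + Poly_Mapping.single (IndX j) 1"
      using keys_mult[of "c j" "mvar (IndX j)"] by (auto simp: mvar_def)
    then have "xdeg s = 0"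
      using assms[OF that] xdeg_pos_iff[of s] by (auto simp: ring_A_def carrier_mpoly_ring)
    then show "t \<in> {t. xdeg t = 1}" using s by (simp add: xdeg_add)
  qed
  moreover have "(\<Sum>j<k. c j * mvar (IndX j)) \<in> carrier (ring_P m k)"
    using * unfolding ring_P_def by (intro mpoly_ring_sum) simp
  ultimately show ?thesis
    using keys_sum[of "\<lambda>j. c j * mvar (IndX j)" "{..<k}"] unfolding linear_forms_def by blast
qed

lemma linear_forms_lincomb:
  fixes p :: "'a::field mpol"
  assumes "p \<in> linear_forms m k"
  obtains c where "\<And>j. j < k \<Longrightarrow> c j \<in> carrier (ring_A m)" "p = (\<Sum>j<k. c j * mvar (IndX j))"
proof -
  have pP: "p \<in> carrier (ring_P m k)" using assms by (simp add: linear_forms_def)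
  have "\<exists>c. (\<forall>j<k. c j \<in> carrier (ring_A m)) \<and> p = (\<Sum>j<k. c j * mvar (IndX j))"
  proof (induct p rule: monomial_induct)
    case zero
    show ?case by (rule exI[of _ "\<lambda>_. 0"]) (simp add: ring_A_def)
  next
    case (add p q)
    then obtain c d where
      "\<forall>j<k. c j \<in> carrier (ring_A m)" "p = (\<Sum>j<k. c j * mvar (IndX j))"
      "\<forall>j<k. d j \<in> carrier (ring_A m)" "q = (\<Sum>j<k. d j * mvar (IndX j))" by blast
    then show ?case
      by (intro exI[of _ "\<lambda>j. c j + d j"]) (auto simp: ring_A_def algebra_simps sum.distrib)
  next
    case (monomial t)
    then have t: "xdeg t = 1" using assms by (auto simp: linear_forms_def)
    then have "0 < xdeg t" by simp
    then obtain j s where js: "IndX j \<in> Poly_Mapping.keys t"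
      "t = s + Poly_Mapping.single (IndX j) 1" "Poly_Mapping.keys s \<subseteq> Poly_Mapping.keys t"
      "xdeg t = Suc (xdeg s)"
      by (rule xdeg_pos_split)
    have j: "j < k" by (rule index_X_less[OF pP monomial js(1)])
    have "Poly_Mapping.keys t \<subseteq> IndA ` {..<m} \<union> IndX ` {..<k}"
      using pP monomial by (simp add: ring_P_def carrier_mpoly_ring)
    moreover have "IndX i \<notin> Poly_Mapping.keys s" for i
      using xdeg_pos_iff[of s] t js(4) by auto
    ultimately have "Poly_Mapping.keys s \<subseteq> IndA ` {..<m}" using js(3) by blast
    then have "Poly_Mapping.single s a \<in> carrier (ring_A m)" for a :: 'a
      unfolding ring_A_def by simp
    moreover have "Poly_Mapping.single t a =
        (\<Sum>i<k. (if i = j then Poly_Mapping.single s a else 0) * mvar (IndX i))" for a :: 'a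
      using j unfolding js(2) single_times_mvar
      by (simp add: if_distrib[of "\<lambda>x. x * _"] cong: if_cong)
    ultimately show ?case
      by (intro exI[of _ "\<lambda>i. if i = j then Poly_Mapping.single s (Poly_Mapping.lookup p t) else 0"])
        (simp add: ring_A_def)
  qed
  then show ?thesis using that by blast
qed

lemma submodule_A_iff:
  "submodule N (ring_A m) (subset_module (ring_P m k) (\<lambda>c. c) (carrier (ring_P m k))) \<longleftrightarrow>
    N \<subseteq> carrier (ring_P m k) \<and> 0 \<in> N \<and> (\<forall>x\<in>N. \<forall>y\<in>N. x + y \<in> N) \<and>
    (\<forall>c\<in>carrier (ring_A m). \<forall>x\<in>N. c * x \<in> N)"
  unfolding submodule_iff_closed[OF cring_A cring_P inclusion_A_P] by simp

lemma A_span_submodule: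
  "B \<subseteq> carrier (ring_P m k) \<Longrightarrow> submodule (A_span m k B) (ring_A m)
    (subset_module (ring_P m k) (\<lambda>c. c) (carrier (ring_P m k)))"
  unfolding A_span_def by (rule gen_submodule_is_submodule[OF cring_A cring_P inclusion_A_P])

lemma A_span_least:
  "submodule N (ring_A m) (subset_module (ring_P m k) (\<lambda>c. c) (carrier (ring_P m k))) \<Longrightarrow>
    B \<subseteq> N \<Longrightarrow> A_span m k B \<subseteq> N"
  unfolding A_span_def by (rule gen_submodule_least)

lemma A_span_superset: "B \<subseteq> A_span m k B"
  unfolding A_span_def by (rule gen_submodule_superset)

lemma linear_forms_mult_A:
  assumes "c \<in> carrier (ring_A m)" "x \<in> linear_forms m k"
  shows "c * x \<in> linear_forms m k"
proof -
  obtain d where d: "\<And>j. j < k \<Longrightarrow> d j \<in> carrier (ring_A m)" "x = (\<Sum>j<k. d j * mvar (IndX j))"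
    by (rule linear_forms_lincomb[OF assms(2)]) blast
  have "c * x = (\<Sum>j<k. (c * d j) * mvar (IndX j))"
    by (simp add: d(2) sum_distrib_left mult.assoc)
  also have "\<dots> \<in> linear_forms m k"
    using assms(1) d(1) by (intro lincomb_in_linear_forms) (auto simp: ring_A_def)
  finally show ?thesis .
qed

lemma linear_forms_submodule:
  "submodule (linear_forms m k) (ring_A m) (subset_module (ring_P m k) (\<lambda>c. c) (carrier (ring_P m k)))"
  unfolding submodule_A_iff
proof (intro conjI ballI)
  show "x + y \<in> linear_forms m k" if "x \<in> linear_forms m k" "y \<in> linear_forms m k" for x y
    using that keys_add[of x y] by (auto simp: linear_forms_def)
qed (use linear_forms_mult_A in \<open>auto simp: linear_forms_def\<close>)

lemma A_span_X_set: "A_span m k (X_set k) = (linear_forms m k :: 'a::field mpol set)" (is "?S = ?L")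
proof
  show "?S \<subseteq> ?L"
    by (rule A_span_least[OF linear_forms_submodule]) (auto simp: X_set_def linear_forms_def, simp add: mvar_def)
  have "submodule (A_span m k (X_set k)) (ring_A m)
      (subset_module (ring_P m k) (\<lambda>c. c) (carrier (ring_P m k) :: 'a mpol set))"
    by (rule A_span_submodule[OF X_set_in_P])
  note span = this[unfolded submodule_A_iff]
  show "?L \<subseteq> ?S"
  proof
    fix x :: "'a mpol" assume "x \<in> linear_forms m k"
    then obtain d where d: "\<And>j. j < k \<Longrightarrow> d j \<in> carrier (ring_A m)" "x = (\<Sum>j<k. d j * mvar (IndX j))"
      by (rule linear_forms_lincomb) blast
    have "(\<Sum>j\<in>F. d j * mvar (IndX j)) \<in> A_span m k (X_set k)" if "finite F" "F \<subseteq> {..<k}" for F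
      using that
    proof (induct F rule: finite_induct)
      case empty
      show ?case using span by simp
    next
      case (insert j F)
      then have "mvar (IndX j) \<in> A_span m k (X_set k)"
        using A_span_superset by (fastforce simp: X_set_def)
      then show ?case using insert d(1)[of j] span by auto
    qed
    then show "x \<in> A_span m k (X_set k)" unfolding d(2) by simp
  qed
qed

lemma xpart_1_in_linear_forms: "f \<in> carrier (ring_P m k) \<Longrightarrow> xpart 1 f \<in> linear_forms m k"
  by (auto simp: linear_forms_def keys_xpart) (auto simp: ring_P_def xpart_closed)

lemma xpart_linear_forms: "l \<in> linear_forms m k \<Longrightarrow> xpart 1 l = l"
  by (auto simp: linear_forms_def intro: xpart_eq_self)

lemma xpart_0_in_A: "f \<in> carrier (ring_P m k) \<Longrightarrow> xpart 0 f \<in> carrier (ring_A m)"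
  unfolding ring_A_def carrier_mpoly_ring keys_xpart
proof safe
  fix t v assume f: "f \<in> carrier (ring_P m k)" and t: "t \<in> Poly_Mapping.keys f" "xdeg t = 0"
    and v: "v \<in> Poly_Mapping.keys t"
  then have "v \<in> IndA ` {..<m} \<union> IndX ` {..<k}"
    by (auto simp: ring_P_def carrier_mpoly_ring)
  then show "v \<in> IndA ` {..<m}" using xdeg_pos_iff[of t] t(2) v by auto
qed

lemma xpart_A:
  assumes "f \<in> carrier (ring_A m)" shows "xpart 0 f = f" "xpart 1 f = 0"
proof -
  have "xdeg t = 0" if "t \<in> Poly_Mapping.keys f" for t
    using assms that xdeg_pos_iff[of t] by (auto simp: ring_A_def carrier_mpoly_ring)
  then show "xpart 0 f = f" "xpart 1 f = 0"
    by (auto intro!: xpart_eq_self xpart_eq_0)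
qed

lemma minus_in_P: "p \<in> carrier (ring_P m k) \<Longrightarrow> q \<in> carrier (ring_P m k) \<Longrightarrow> p - q \<in> carrier (ring_P m k)"
  using ring_P_closed(3)[of p m k "- q"] ring_P_closed(5)[of q m k] by simp

lemma minus_linear_part:
  assumes "f \<in> carrier (ring_P m k)"
  shows "f - xpart 0 f - xpart 1 f \<in> xord_ge m k 2"
proof -
  have "xpart d f \<in> carrier (ring_P m k)" for d using assms by (simp add: ring_P_def xpart_closed)
  then have "f - xpart 0 f - xpart 1 f \<in> carrier (ring_P m k)" using assms minus_in_P by blast
  moreover have "2 \<le> xdeg t" if "t \<in> Poly_Mapping.keys (f - xpart 0 f - xpart 1 f)" for t
    using that by (cases "xdeg t = 0"; cases "xdeg t = 1")
      (auto simp: in_keys_iff lookup_minus xpart_def xdeg_def lookup_hom_component)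
  ultimately show ?thesis by (simp add: xord_ge_def)
qed

text \<open>
  The components of degrees \<open>0\<close>, \<open>1\<close> and at least \<open>2\<close> provide the decomposition in the definition of
  \<open>Lin_A\<close>; conversely, any such decomposition is recovered by taking components.
\<close>

lemma Lin_A_eq:
  assumes "f \<in> carrier (ring_P m k)"
  shows "Lin_A m k f = xpart 1 f"
  unfolding Lin_A_def
proof (rule the_equality)
  obtain c where c: "\<And>j. j < k \<Longrightarrow> c j \<in> carrier (ring_A m)" "xpart 1 f = (\<Sum>j<k. c j * mvar (IndX j))"
    by (rule linear_forms_lincomb[OF xpart_1_in_linear_forms[OF assms]]) blast
  then show "\<exists>f0 c g. f0 \<in> carrier (ring_A m) \<and> (\<forall>j<k. c j \<in> carrier (ring_A m)) \<and>
      g \<in> X_ideal_sq m k \<and> f = f0 + (\<Sum>j<k. c j * mvar (IndX j)) + g \<and>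
      xpart 1 f = (\<Sum>j<k. c j * mvar (IndX j))"
    using xpart_0_in_A[OF assms] minus_linear_part[OF assms]
    by (intro exI[of _ "xpart 0 f"] exI[of _ c] exI[of _ "f - xpart 0 f - xpart 1 f"])
      (simp add: X_ideal_sq_eq)
next
  fix l assume "\<exists>f0 c g. f0 \<in> carrier (ring_A m) \<and> (\<forall>j<k. c j \<in> carrier (ring_A m)) \<and>
      g \<in> X_ideal_sq m k \<and> f = f0 + (\<Sum>j<k. c j * mvar (IndX j)) + g \<and>
      l = (\<Sum>j<k. c j * mvar (IndX j))"
  then obtain f0 c g where f: "f0 \<in> carrier (ring_A m)" "\<forall>j<k. c j \<in> carrier (ring_A m)"
    "g \<in> xord_ge m k 2" "f = f0 + l + g" "l = (\<Sum>j<k. c j * mvar (IndX j))"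
    by (auto simp: X_ideal_sq_eq)
  have "l \<in> linear_forms m k" unfolding f(5) using f(2) by (intro lincomb_in_linear_forms) blast
  moreover have "xpart 1 g = 0" using f(3) by (intro xpart_eq_0) (auto simp: xord_ge_def)
  ultimately show "l = xpart 1 f"
    unfolding f(4) xpart_simps using xpart_A(2)[OF f(1)] xpart_linear_forms[of l m k] by simp
qed

section \<open>The linear part of an ideal\<close>

lemma set_add_P: "x \<in> I <+>\<^bsub>ring_P m k\<^esub> J \<longleftrightarrow> (\<exists>i\<in>I. \<exists>j\<in>J. x = i + j)"
  by (auto simp: set_add_def')

lemma xord_ge_uminus: "p \<in> xord_ge m k n \<Longrightarrow> - p \<in> xord_ge m k n"
  by (auto simp: xord_ge_def in_keys_iff)

text \<open>
  Part (a) before passing to the generated module: if \<open>f \<in> I\<close> has linear part \<open>l\<close>, then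
  \<open>f - l \<in> \<langle>X\<rangle>\<^sup>2\<close> since \<open>f\<close> has no component of degree \<open>0\<close>.
\<close>

lemma Lin_A_image:
  assumes "ideal I (ring_P m k)" "I \<subseteq> X_ideal m k"
  shows "Lin_A m k ` I = A_span m k (X_set k) \<inter> (I <+>\<^bsub>ring_P m k\<^esub> X_ideal_sq m k)"
proof -
  interpret I: ideal I "ring_P m k" by fact
  have IP: "f \<in> carrier (ring_P m k)" if "f \<in> I" for f using that I.Icarr by blast
  show ?thesis
    unfolding A_span_X_set X_ideal_sq_eq
  proof (intro equalityI subsetI)
    fix l assume "l \<in> Lin_A m k ` I"
    then obtain f where f: "f \<in> I" "l = xpart 1 f" using Lin_A_eq IP by blast
    then have "xpart 0 f = 0" using assms(2) xpart_0_X_ideal by blast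
    then have "f - l \<in> xord_ge m k 2" using minus_linear_part[OF IP[OF f(1)]] f(2) by simp
    then have "- (f - l) \<in> xord_ge m k 2" by (rule xord_ge_uminus)
    then have "l \<in> I <+>\<^bsub>ring_P m k\<^esub> xord_ge m k 2"
      unfolding set_add_P using f(1) by (intro bexI[of _ f] bexI[of _ "- (f - l)"]) simp_all
    then show "l \<in> linear_forms m k \<inter> (I <+>\<^bsub>ring_P m k\<^esub> xord_ge m k 2)"
      using xpart_1_in_linear_forms[OF IP[OF f(1)]] f(2) by simp
  next
    fix l assume "l \<in> linear_forms m k \<inter> (I <+>\<^bsub>ring_P m k\<^esub> xord_ge m k 2)"
    then obtain f q where l: "l \<in> linear_forms m k" "f \<in> I" "q \<in> xord_ge m k 2" "l = f + q"
      unfolding Int_iff set_add_P by blast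
    have "xpart 1 q = 0" using l(3) xpart_1_X_ideal_sq unfolding X_ideal_sq_eq by blast
    then have "xpart 1 f = xpart 1 l" unfolding l(4) xpart_simps by simp
    then have "l = Lin_A m k f" using xpart_linear_forms[OF l(1)] Lin_A_eq[OF IP[OF l(2)]] by simp
    then show "l \<in> Lin_A m k ` I" using l(2) by blast
  qed
qed

lemma Lin_A_ideal_eq:
  assumes "ideal I (ring_P m k)" "I \<subseteq> X_ideal m k"
  shows "Lin_A_ideal m k I = A_span m k (X_set k) \<inter> (I <+>\<^bsub>ring_P m k\<^esub> X_ideal_sq m k)"
proof -
  let ?U = "I <+>\<^bsub>ring_P m k\<^esub> X_ideal_sq m k"
  interpret P: cring "ring_P m k" by (rule cring_P)
  interpret U: ideal ?U "ring_P m k"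
    unfolding X_ideal_sq_eq by (rule P.add_ideals[OF assms(1) xord_ge_ideal])
  have U: "submodule ?U (ring_A m) (subset_module (ring_P m k) (\<lambda>c. c) (carrier (ring_P m k)))"
    by (rule ideal_is_submodule[OF cring_A cring_P inclusion_A_P U.ideal_axioms])
  have "submodule (A_span m k (X_set k) \<inter> ?U) (ring_A m)
      (subset_module (ring_P m k) (\<lambda>c. c) (carrier (ring_P m k)))"
    using U A_span_submodule[OF X_set_in_P[of k m]] unfolding submodule_A_iff by blast
  then have "Lin_A_ideal m k I \<subseteq> A_span m k (X_set k) \<inter> ?U"
    unfolding Lin_A_ideal_def using Lin_A_image[OF assms] by (intro A_span_least) auto
  moreover have "A_span m k (X_set k) \<inter> ?U \<subseteq> Lin_A_ideal m k I"
    unfolding Lin_A_ideal_def using Lin_A_image[OF assms] A_span_superset[of _ m k] by metis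
  ultimately show ?thesis by blast
qed

text \<open>
  The elements of \<open>\<langle>X\<rangle>\<close> whose linear part lies in the span of the linear parts of \<open>G\<close> form an
  ideal containing \<open>G\<close>, by the product rule.
\<close>

lemma Lin_A_ideal_generators:
  assumes "G \<subseteq> X_ideal m k"
  shows "Lin_A_ideal m k (Idl\<^bsub>ring_P m k\<^esub> G) = A_span m k (Lin_A m k ` G)"
proof -
  interpret P: cring "ring_P m k" by (rule cring_P)
  interpret X: ideal "X_ideal m k" "ring_P m k" unfolding X_ideal_eq by (rule xord_ge_ideal)
  let ?S = "A_span m k (Lin_A m k ` G)"
  have XP: "f \<in> carrier (ring_P m k)" if "f \<in> X_ideal m k" for f using that X.Icarr by blast
  then have GP: "G \<subseteq> carrier (ring_P m k)" using assms by blast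
  have "Lin_A m k g \<in> linear_forms m k" if "g \<in> G" for g
  proof -
    have "g \<in> carrier (ring_P m k)" using that GP by blast
    then show ?thesis by (simp only: Lin_A_eq xpart_1_in_linear_forms)
  qed
  then have LP: "Lin_A m k ` G \<subseteq> carrier (ring_P m k)" unfolding linear_forms_def by blast
  note sub = A_span_submodule[OF LP] and S = A_span_submodule[OF LP, unfolded submodule_A_iff]
  let ?T = "{f \<in> X_ideal m k. xpart 1 f \<in> ?S}"
  have "ideal ?T (ring_P m k)"
  proof (rule ideal_of_closed[OF cring_P])
    show "\<zero>\<^bsub>ring_P m k\<^esub> \<in> ?T" using S X.zero_closed by (simp add: xpart_simps)
    show "x \<oplus>\<^bsub>ring_P m k\<^esub> y \<in> ?T" if "x \<in> ?T" "y \<in> ?T" for x y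
      using that S X.a_closed[of x y] by (simp add: xpart_simps(2))
    show "r \<otimes>\<^bsub>ring_P m k\<^esub> x \<in> ?T" if r: "r \<in> carrier (ring_P m k)" and x: "x \<in> ?T" for r x
    proof -
      have "xpart 0 x = 0" using x xpart_0_X_ideal by blast
      then have "xpart 1 (r * x) = xpart 0 r * xpart 1 x" unfolding xpart_1_mult by simp
      then have "xpart 1 (r * x) \<in> ?S" using S xpart_0_in_A[OF r] x by auto
      then show ?thesis using X.I_l_closed[of x r] r x by simp
    qed
  qed (use XP in blast)
  moreover have "G \<subseteq> ?T"
  proof
    fix g assume g: "g \<in> G"
    then have "Lin_A m k g \<in> ?S" using A_span_superset[of "Lin_A m k ` G" m k] by blast
    then show "g \<in> ?T" using g assms Lin_A_eq[of g m k] GP by auto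
  qed
  ultimately have T: "Idl\<^bsub>ring_P m k\<^esub> G \<subseteq> ?T" by (rule P.genideal_minimal)
  have "Lin_A m k ` (Idl\<^bsub>ring_P m k\<^esub> G) \<subseteq> ?S"
  proof
    fix l assume "l \<in> Lin_A m k ` (Idl\<^bsub>ring_P m k\<^esub> G)"
    then obtain f where "f \<in> Idl\<^bsub>ring_P m k\<^esub> G" "l = Lin_A m k f" by blast
    moreover from this have "f \<in> ?T" using T by blast
    ultimately show "l \<in> ?S" using Lin_A_eq[of f m k] XP[of f] by simp
  qed
  then have "Lin_A_ideal m k (Idl\<^bsub>ring_P m k\<^esub> G) \<subseteq> ?S"
    unfolding Lin_A_ideal_def by (rule A_span_least[OF sub])
  moreover have "?S \<subseteq> Lin_A_ideal m k (Idl\<^bsub>ring_P m k\<^esub> G)"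
    unfolding Lin_A_ideal_def A_span_def gen_submodule_def
    by (intro hull_mono image_mono P.genideal_self GP)
  ultimately show ?thesis by blast
qed

text \<open>
  With positive weights, weighted degree \<open>0\<close> means the same as \<open>xdeg = 0\<close>, so the component of
  \<open>f \<in> I\<close> in degree \<open>0\<close> belongs to both \<open>I\<close> and \<open>A\<close>.
\<close>

lemma positive_algebra_le_X_ideal:
  assumes "positive_algebra m k w I"
  shows "I \<subseteq> X_ideal m k"
proof
  fix f assume f: "f \<in> I"
  have w: "\<forall>j<k. 0 < w j" and I: "ideal I (ring_P m k)" and hom: "W_homogeneous w I"
    and IA: "I \<inter> carrier (ring_A m) = {0}"
    using assms by (auto simp: positive_algebra_def)
  have fP: "f \<in> carrier (ring_P m k)" using ideal.Icarr[OF I f] .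
  let ?f0 = "hom_component (W_weight w) 0 f"
  have pos: "wdeg (W_weight w) t = 0 \<longleftrightarrow> xdeg t = 0" if t: "t \<in> Poly_Mapping.keys f" for t
  proof -
    have "W_weight w v = 0 \<longleftrightarrow> W_weight (\<lambda>_. 1) v = 0" if "v \<in> Poly_Mapping.keys t" for v
      using that w index_X_less[OF fP t] by (cases v) (auto simp: W_weight_def)
    then show ?thesis unfolding xdeg_def wdeg_def by auto
  qed
  have "?f0 = xpart 0 f"
    unfolding xpart_def using pos by (intro hom_component_cong) (simp add: xdeg_def)
  then have "xpart 0 f \<in> I \<inter> carrier (ring_A m)"
    using hom f xpart_0_in_A[OF fP] unfolding W_homogeneous_def by (metis IntI)
  then have "xpart 0 f = 0" using IA by blast
  then have "0 < xdeg t" if "t \<in> Poly_Mapping.keys f" for t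
    using keys_xpart[of 0 f] that by auto
  then show "f \<in> X_ideal m k" using fP by (auto simp: X_ideal_eq xord_ge_def Suc_le_eq)
qed

section \<open>The substitution homomorphism\<close>

definition eps_monomial :: "(nat \<Rightarrow> 'a::field) \<Rightarrow> (indet \<Rightarrow>\<^sub>0 nat) \<Rightarrow> 'a mpol" where
  "eps_monomial \<gamma> t = (\<Prod>v\<in>Poly_Mapping.keys t.
     (case v of IndA i \<Rightarrow> mconst (\<gamma> i) | IndX j \<Rightarrow> mvar (IndX j)) ^ Poly_Mapping.lookup t v)"

lemma eps_monomial_superset:
  assumes "finite F" "Poly_Mapping.keys t \<subseteq> F"
  shows "eps_monomial \<gamma> t = (\<Prod>v\<in>F.
     (case v of IndA i \<Rightarrow> mconst (\<gamma> i) | IndX j \<Rightarrow> mvar (IndX j)) ^ Poly_Mapping.lookup t v)"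
  unfolding eps_monomial_def
  by (rule prod.mono_neutral_left[OF assms]) (simp add: in_keys_iff)

lemma eps_monomial_add: "eps_monomial \<gamma> (s + t) = eps_monomial \<gamma> s * eps_monomial \<gamma> t"
proof -
  let ?F = "Poly_Mapping.keys s \<union> Poly_Mapping.keys t"
  show ?thesis
    using keys_add[of s t]
    by (simp add: eps_monomial_superset[of ?F] lookup_add power_add prod.distrib)
qed

text \<open>
  A summation range independent of the polynomial, as needed for additivity.
\<close>

lemma eps_superset:
  assumes "finite F" "Poly_Mapping.keys p \<subseteq> F"
  shows "eps \<gamma> p = (\<Sum>t\<in>F. mconst (Poly_Mapping.lookup p t) * eps_monomial \<gamma> t)"
  unfolding eps_def eps_monomial_def
  by (rule sum.mono_neutral_left[OF assms]) (simp add: in_keys_iff mconst_simps)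

lemma eps_0 [simp]: "eps \<gamma> 0 = 0"
  by (simp add: eps_def)

lemma eps_add: "eps \<gamma> (p + q) = eps \<gamma> p + eps \<gamma> q"
proof -
  let ?F = "Poly_Mapping.keys p \<union> Poly_Mapping.keys q"
  show ?thesis
    using keys_add[of p q]
    by (simp add: eps_superset[of ?F] lookup_add mconst_simps algebra_simps sum.distrib)
qed

lemma eps_single: "eps \<gamma> (Poly_Mapping.single t c) = mconst c * eps_monomial \<gamma> t"
  by (subst eps_superset[of "{t}"]) auto

lemma eps_mult: "eps \<gamma> (p * q) = eps \<gamma> p * eps \<gamma> q"
proof (induct p rule: monomial_induct)
  case (monomial s)
  show ?case
  proof (induct q rule: monomial_induct)
    case (monomial t)
    show ?case by (simp add: mult_single eps_single eps_monomial_add mconst_simps)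
  qed (simp_all add: eps_add algebra_simps)
qed (simp_all add: eps_add algebra_simps)

lemma eps_mconst [simp]: "eps \<gamma> (mconst c) = mconst c"
  using eps_single[of \<gamma> 0 c] by (simp add: mconst_def eps_monomial_def)

lemma eps_mvar [simp]:
  "eps \<gamma> (mvar (IndA i)) = mconst (\<gamma> i)" "eps \<gamma> (mvar (IndX j)) = mvar (IndX j)"
  using eps_single[of \<gamma> "Poly_Mapping.single (IndA i) 1" 1]
    eps_single[of \<gamma> "Poly_Mapping.single (IndX j) 1" 1]
  by (simp_all add: mvar_def eps_monomial_def mconst_simps)

lemma eps_closed:
  assumes "p \<in> carrier (ring_P m k)"
  shows "eps \<gamma> p \<in> carrier (ring_P 0 k)"
proof -
  have "eps_monomial \<gamma> t \<in> carrier (ring_P 0 k)" if t: "t \<in> Poly_Mapping.keys p" for t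
    unfolding eps_monomial_def ring_P_def
  proof (intro mpoly_ring_prod mpoly_ring_power)
    fix v assume "v \<in> Poly_Mapping.keys t"
    then show "(case v of IndA i \<Rightarrow> mconst (\<gamma> i) | IndX j \<Rightarrow> mvar (IndX j)) \<in>
        carrier (mpoly_ring (IndA ` {..<0} \<union> IndX ` {..<k}))"
      using index_X_less[OF assms t] by (cases v) auto
  qed
  then show ?thesis
    unfolding eps_superset[OF finite_keys subset_refl] ring_P_def
    by (intro mpoly_ring_sum mpoly_ring_closed mpoly_ring_mconst) auto
qed

lemma mvar_power: "mvar v ^ n = Poly_Mapping.single (Poly_Mapping.single v n) 1"
  by (induct n) (simp_all add: mvar_def mult_single flip: single_add)

lemma prod_single:
  "(\<Prod>v\<in>F. Poly_Mapping.single (s v) (1::'a::field)) = Poly_Mapping.single (\<Sum>v\<in>F. s v) 1"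
  by (induct F rule: infinite_finite_induct) (simp_all add: mult_single)

text \<open>
  The substitution is a retraction of \<open>P\<close> onto \<open>K[X]\<close>; its surjectivity rests on this.
\<close>

lemma eps_id:
  assumes "p \<in> carrier (ring_P 0 k)"
  shows "eps \<gamma> p = p"
proof (induct p rule: monomial_induct)
  case (monomial t)
  have "eps_monomial \<gamma> t = (\<Prod>v\<in>Poly_Mapping.keys t. mvar v ^ Poly_Mapping.lookup t v)"
    unfolding eps_monomial_def
  proof (intro prod.cong refl)
    fix v assume "v \<in> Poly_Mapping.keys t"
    then have "v \<in> IndX ` {..<k}"
      using assms monomial by (auto simp: ring_P_def carrier_mpoly_ring)
    then show "(case v of IndA i \<Rightarrow> mconst (\<gamma> i) | IndX j \<Rightarrow> mvar (IndX j)) ^ Poly_Mapping.lookup t v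
        = mvar v ^ Poly_Mapping.lookup t v" by auto
  qed
  also have "\<dots> = Poly_Mapping.single t 1"
    unfolding mvar_power prod_single poly_mapping_eq_sum_single[of t, symmetric] ..
  finally show ?case by (simp add: eps_single mconst_simps)
qed (simp_all add: eps_add)

lemma eps_hom: "eps \<gamma> \<in> ring_hom (ring_P m k) (ring_P 0 k)"
  by (rule ring_hom_memI)
    (simp_all add: eps_closed eps_add eps_mult eps_mconst[of \<gamma> 1, unfolded mconst_simps])

lemma P_0_le_P: "carrier (ring_P 0 k) \<subseteq> carrier (ring_P m k)"
  unfolding ring_P_def by (rule mpoly_ring_mono) auto

lemma eps_surj:
  fixes \<gamma> :: "nat \<Rightarrow> 'a::field"
  shows "eps \<gamma> ` carrier (ring_P m k) = carrier (ring_P 0 k)"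
proof
  show "carrier (ring_P 0 k) \<subseteq> eps \<gamma> ` carrier (ring_P m k)"
  proof
    fix p :: "'a mpol" assume "p \<in> carrier (ring_P 0 k)"
    then have "p = eps \<gamma> p" "p \<in> carrier (ring_P m k)"
      using eps_id P_0_le_P by (metis, blast)
    then show "p \<in> eps \<gamma> ` carrier (ring_P m k)" by (rule image_eqI)
  qed
qed (use eps_closed in blast)

lemma M_Gamma0_ideal: "ideal (M_Gamma0 m k \<gamma>) (ring_P m k)"
proof -
  interpret P: cring "ring_P m k" by (rule cring_P)
  show ?thesis
    unfolding M_Gamma0_def
  proof (rule P.genideal_ideal, safe)
    fix i assume "i < m"
    then show "mvar (IndA i) - mconst (\<gamma> i) \<in> carrier (ring_P m k)"
      by (intro minus_in_P) (simp_all add: ring_P_def)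
  qed (use X_set_in_P in blast)
qed

lemma X_ideal_le_M_Gamma0: "X_ideal m k \<subseteq> M_Gamma0 m k \<gamma>"
proof -
  interpret P: cring "ring_P m k" by (rule cring_P)
  have "X_set k \<subseteq> M_Gamma0 m k \<gamma>"
    unfolding M_Gamma0_def genideal_def by blast
  then show ?thesis unfolding X_ideal_def by (rule P.genideal_minimal[OF M_Gamma0_ideal])
qed

text \<open>
  The generators \<open>a\<^sub>i - \<gamma>\<^sub>i\<close> are sent to \<open>0\<close> and the \<open>x\<^sub>j\<close> are fixed.
\<close>

lemma eps_M_Gamma0:
  fixes \<gamma> :: "nat \<Rightarrow> 'a::field"
  shows "eps \<gamma> ` M_Gamma0 m k \<gamma> = X_ideal 0 k"
proof
  interpret P: cring "ring_P m k :: 'a mpol ring" by (rule cring_P)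
  interpret KX: cring "ring_P 0 k :: 'a mpol ring" by (rule cring_P)
  interpret e: ring_hom_ring "ring_P m k" "ring_P 0 k" "eps \<gamma>"
    by (intro ring_hom_ringI2 P.ring_axioms KX.ring_axioms eps_hom)
  have X: "ideal (X_ideal 0 k :: 'a mpol set) (ring_P 0 k)" unfolding X_ideal_eq by (rule xord_ge_ideal)
  have X_sub: "X_set k \<subseteq> (X_ideal 0 k :: 'a mpol set)"
    unfolding X_ideal_def by (rule KX.genideal_self[OF X_set_in_P])
  have "M_Gamma0 m k \<gamma> \<subseteq> {r \<in> carrier (ring_P m k). eps \<gamma> r \<in> X_ideal 0 k}"
    unfolding M_Gamma0_def
  proof (rule P.genideal_minimal[OF e.ideal_vimage[OF X]], safe)
    fix i assume i: "i < m"
    show "mvar (IndA i) - mconst (\<gamma> i) \<in> carrier (ring_P m k)"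
      using i by (intro minus_in_P) (simp_all add: ring_P_def)
    have "mvar (IndA i) - mconst (\<gamma> i) = mvar (IndA i) + mconst (- \<gamma> i)"
      by (simp add: mconst_def single_uminus)
    then have "eps \<gamma> (mvar (IndA i) - mconst (\<gamma> i)) = mconst (\<gamma> i) + mconst (- \<gamma> i)"
      by (simp only: eps_add eps_mvar eps_mconst)
    also have "\<dots> = 0" by (simp add: mconst_simps flip: mconst_simps(1))
    finally show "eps \<gamma> (mvar (IndA i) - mconst (\<gamma> i)) \<in> X_ideal 0 k"
      by (simp add: X_ideal_eq xord_ge_def)
  next
    fix x :: "'a mpol" assume x: "x \<in> X_set k"
    then show "x \<in> carrier (ring_P m k)" using X_set_in_P by blast
    have "eps \<gamma> x = x" using x by (auto simp: X_set_def)
    then show "eps \<gamma> x \<in> X_ideal 0 k" using x X_sub by auto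
  qed
  then show "eps \<gamma> ` M_Gamma0 m k \<gamma> \<subseteq> X_ideal 0 k" by blast
  show "X_ideal 0 k \<subseteq> eps \<gamma> ` M_Gamma0 m k \<gamma>"
  proof
    fix x :: "'a mpol" assume x: "x \<in> X_ideal 0 k"
    then have "x \<in> X_ideal m k"
      using P_0_le_P[of k m] by (auto simp: X_ideal_eq xord_ge_def)
    moreover have "eps \<gamma> x = x" using x by (intro eps_id[where k = k]) (simp add: X_ideal_eq xord_ge_def)
    ultimately show "x \<in> eps \<gamma> ` M_Gamma0 m k \<gamma>" using X_ideal_le_M_Gamma0 by (metis imageI subsetD)
  qed
qed

lemma eps_M_Gamma0_sq:
  "eps \<gamma> ` ideal_prod (ring_P m k) (M_Gamma0 m k \<gamma>) (M_Gamma0 m k \<gamma>) = X_ideal_sq 0 k"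
  unfolding X_ideal_sq_def eps_M_Gamma0[of \<gamma> m k, symmetric]
  by (rule ideal_prod_hom_image[symmetric, OF _ eps_hom])
    (use cring.axioms(1)[OF cring_P] ideal.Icarr[OF M_Gamma0_ideal] in auto)

section \<open>Linear parts over the field\<close>

lemma carrier_ring_A_0: "carrier (ring_A 0) = range mconst"
proof (intro equalityI subsetI)
  fix p :: "'a mpol" assume p: "p \<in> carrier (ring_A 0)"
  have "p = mconst (Poly_Mapping.lookup p 0)"
  proof (intro poly_mapping_eqI)
    fix t
    have "Poly_Mapping.lookup p t = 0" if "t \<noteq> 0"
    proof (rule ccontr)
      assume "Poly_Mapping.lookup p t \<noteq> 0"
      then have "Poly_Mapping.keys t = {}"
        using p by (auto simp: ring_A_def carrier_mpoly_ring in_keys_iff)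
      then show False using that by simp
    qed
    then show "Poly_Mapping.lookup p t = Poly_Mapping.lookup (mconst (Poly_Mapping.lookup p 0)) t"
      by (auto simp: mconst_def lookup_single when_def)
  qed
  then show "p \<in> range mconst" by blast
qed (auto simp: ring_A_def)

lemma mconst_hom_P: "mconst \<in> ring_hom ring_K (ring_P m k)"
  unfolding ring_P_def by (rule mconst_hom)

text \<open>
  For \<open>m = 0\<close> the ring \<open>A\<close> consists of the constants, so \<open>K\<close>-subspaces of \<open>K[X]\<close> and submodules over
  this copy of \<open>K\<close> coincide.
\<close>

lemma submodule_K_iff_A_0:
  "submodule N ring_K (subset_module (ring_P 0 k) mconst (carrier (ring_P 0 k))) \<longleftrightarrow>
   submodule N (ring_A 0) (subset_module (ring_P 0 k) (\<lambda>c. c) (carrier (ring_P 0 k)))"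
  unfolding submodule_A_iff submodule_iff_closed[OF cring_ring_K cring_P mconst_hom_P] carrier_ring_A_0
  by (simp add: ring_K_def ring_of_type_algebra_def)

lemma K_span_eq: "K_span k B = A_span 0 k B"
  unfolding K_span_def A_span_def gen_submodule_def ring_KX_eq submodule_K_iff_A_0 ..

text \<open>
  On monomials without \<open>a\<close>'s the standard degree is \<open>xdeg\<close>, so both sides collect the same linear
  components.
\<close>

lemma Lin_X_eq:
  assumes "J \<subseteq> carrier (ring_P 0 k)"
  shows "Lin_X k J = Lin_A_ideal 0 k J"
proof -
  have "hom_component (\<lambda>_. 1) 1 f = Lin_A 0 k f" if "f \<in> J" for f
  proof -
    have fP: "f \<in> carrier (ring_P 0 k)" using that assms by blast
    have "wdeg (\<lambda>_. 1) t = xdeg t" if t: "t \<in> Poly_Mapping.keys f" for t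
      unfolding xdeg_def wdeg_def
    proof (intro sum.cong refl)
      fix v assume "v \<in> Poly_Mapping.keys t"
      then have "v \<in> IndX ` {..<k}"
        using fP t by (auto simp: ring_P_def carrier_mpoly_ring)
      then show "Poly_Mapping.lookup t v * 1 = Poly_Mapping.lookup t v * W_weight (\<lambda>_. 1) v"
        by (auto simp: W_weight_def)
    qed
    then have "hom_component (\<lambda>_. 1) 1 f = xpart 1 f"
      unfolding xpart_def by (intro hom_component_cong) (simp add: xdeg_def)
    then show ?thesis by (simp only: Lin_A_eq[OF fP])
  qed
  then have "hom_component (\<lambda>_. 1) 1 ` J = Lin_A 0 k ` J" by (intro image_cong refl)
  then show ?thesis by (simp only: Lin_X_def Lin_A_ideal_def K_span_eq)
qed

section \<open>Cotangent spaces\<close>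

text \<open>
  The class of \<open>f \<in> J\<close> in the cotangent space of \<open>P/I\<close> at the image of \<open>J\<close>, a coset of cosets.
\<close>

definition Cot_class ::
    "nat \<Rightarrow> nat \<Rightarrow> 'a::field mpol set \<Rightarrow> 'a mpol set \<Rightarrow> 'a mpol \<Rightarrow> 'a mpol set set" where
  "Cot_class m k I J f =
     (let P = ring_P m k; \<mm> = quot_ideal P I J
      in ideal_prod (P Quot I) \<mm> \<mm> +>\<^bsub>P Quot I\<^esub> (I +>\<^bsub>P\<^esub> f))"

lemma Cot_class_epi:
  assumes "ideal I (ring_P m k)" "ideal J (ring_P m k)"
  shows "Cot_class m k I J \<in> module_epi_set ring_K (subset_module (ring_P m k) mconst J)
    (Cot (ring_P m k Quot I) (quot_const (ring_P m k) I) (quot_ideal (ring_P m k) I J))"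
proof -
  have "Cot_class m k I J = (\<lambda>f. ideal_prod (ring_P m k Quot I)
      (quot_ideal (ring_P m k) I J) (quot_ideal (ring_P m k) I J)
      +>\<^bsub>ring_P m k Quot I\<^esub> (I +>\<^bsub>ring_P m k\<^esub> f))"
    by (simp add: fun_eq_iff Cot_class_def Let_def)
  moreover have "quot_const (ring_P m k) I = (\<lambda>c. I +>\<^bsub>ring_P m k\<^esub> mconst c)"
    by (simp add: fun_eq_iff quot_const_def)
  ultimately show ?thesis
    using Cot_quot_epi[OF cring_ring_K cring_P mconst_hom_P assms] by simp
qed

lemma Cot_class_eq_iff:
  assumes "ideal I (ring_P m k)" "ideal J (ring_P m k)" "f \<in> J" "g \<in> J"
  shows "Cot_class m k I J f = Cot_class m k I J g \<longleftrightarrow>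
    (\<exists>i\<in>I. \<exists>t\<in>ideal_prod (ring_P m k) J J. f = i + (t + g))"
  using Cot_quot_eq_iff[OF cring_ring_K cring_P mconst_hom_P assms]
  by (simp add: Cot_class_def Let_def)

lemma linear_forms_le_X_ideal: "linear_forms m k \<subseteq> X_ideal m k"
  by (auto simp: linear_forms_def X_ideal_eq xord_ge_def)

lemma linear_forms_minus:
  assumes "l \<in> linear_forms m k" "l' \<in> linear_forms m k" shows "l - l' \<in> linear_forms m k"
proof -
  have "l - l' \<in> carrier (ring_P m k)" using assms minus_in_P by (auto simp: linear_forms_def)
  moreover have "xpart 1 (l - l' + l') = xpart 1 (l - l') + xpart 1 l'" by (rule xpart_simps)
  then have "xpart 1 (l - l') = l - l'"
    unfolding diff_add_cancel xpart_linear_forms[OF assms(1)] xpart_linear_forms[OF assms(2)]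
    by (simp only: eq_diff_eq)
  ultimately show ?thesis using xpart_1_in_linear_forms by metis
qed

text \<open>
  Modulo \<open>\<langle>X\<rangle>\<^sup>2\<close> an element of \<open>\<langle>X\<rangle>\<close> agrees with its linear part.
\<close>

lemma Cot_class_xpart:
  assumes "ideal J (ring_P 0 k)" "f \<in> X_ideal 0 k"
  shows "Cot_class 0 k J (X_ideal 0 k) f = Cot_class 0 k J (X_ideal 0 k) (xpart 1 f)"
proof -
  have fP: "f \<in> carrier (ring_P 0 k)" by (rule X_ideal_in_P[OF assms(2)])
  have "xpart 1 f \<in> X_ideal 0 k" using xpart_1_in_linear_forms[OF fP] linear_forms_le_X_ideal by blast
  moreover have "f - xpart 1 f \<in> X_ideal_sq 0 k"
    using minus_linear_part[OF fP] xpart_0_X_ideal[OF assms(2)] by (simp add: X_ideal_sq_eq)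
  moreover have "0 \<in> J"
    using additive_subgroup.zero_closed[OF ideal.axioms(1)[OF assms(1)]] by simp
  moreover have "f = 0 + ((f - xpart 1 f) + xpart 1 f)" by simp
  ultimately show ?thesis
    unfolding Cot_class_eq_iff[OF assms(1) X_ideal_ideal assms(2) \<open>xpart 1 f \<in> X_ideal 0 k\<close>]
      X_ideal_sq_def by blast
qed

lemma linear_forms_submodule_K:
  "submodule (linear_forms 0 k) ring_K (subset_module (ring_P 0 k) mconst (carrier (ring_P 0 k)))"
  unfolding submodule_K_iff_A_0 by (rule linear_forms_submodule)

lemma linear_forms_module: "module ring_K (subset_module (ring_P 0 k) mconst (linear_forms 0 k))"
  by (rule module_on_submodule[OF cring_ring_K cring_P mconst_hom_P linear_forms_submodule_K])

lemma Lin_ideal_submodule_K: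
  fixes J :: "'a::field mpol set"
  assumes "ideal J (ring_P 0 k)" "J \<subseteq> X_ideal 0 k"
  shows "submodule (Lin_A_ideal 0 k J) ring_K (subset_module (ring_P 0 k) mconst (linear_forms 0 k))"
proof -
  have "Lin_A 0 k f \<in> linear_forms 0 k" if "f \<in> J" for f
  proof -
    have "f \<in> carrier (ring_P 0 k)" using that assms(2) X_ideal_in_P by blast
    then show ?thesis by (simp only: Lin_A_eq xpart_1_in_linear_forms)
  qed
  then have "Lin_A 0 k ` J \<subseteq> carrier (ring_P 0 k)" unfolding linear_forms_def by blast
  then have "submodule (Lin_A_ideal 0 k J) (ring_A 0)
      (subset_module (ring_P 0 k) (\<lambda>c. c) (carrier (ring_P 0 k)))"
    unfolding Lin_A_ideal_def by (rule A_span_submodule)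
  moreover have "Lin_A_ideal 0 k J \<subseteq> linear_forms 0 k"
    unfolding Lin_A_ideal_eq[OF assms] A_span_X_set by blast
  ultimately show ?thesis
    unfolding submodule_K_iff_A_0[symmetric]
    by (intro submodule_of_submodule[OF cring_ring_K cring_P mconst_hom_P linear_forms_submodule_K])
qed

lemma Lin_quotient_epi:
  assumes "ideal J (ring_P 0 k)" "J \<subseteq> X_ideal 0 k"
  shows "(\<lambda>l. Lin_A_ideal 0 k J +>\<^bsub>ring_P 0 k\<^esub> l) \<in> module_epi_set ring_K
      (subset_module (ring_P 0 k) mconst (linear_forms 0 k))
      (quot_module (subset_module (ring_P 0 k) mconst (linear_forms 0 k)) (Lin_A_ideal 0 k J))"
  using quot_module_epi[OF linear_forms_module Lin_ideal_submodule_K[OF assms]] by simp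

lemma Lin_coset_eq_iff:
  assumes "ideal J (ring_P 0 k)" "J \<subseteq> X_ideal 0 k" "l \<in> linear_forms 0 k" "l' \<in> linear_forms 0 k"
  shows "Lin_A_ideal 0 k J +>\<^bsub>ring_P 0 k\<^esub> l = Lin_A_ideal 0 k J +>\<^bsub>ring_P 0 k\<^esub> l' \<longleftrightarrow>
    l - l' \<in> Lin_A_ideal 0 k J"
proof -
  let ?M = "subset_module (ring_P 0 k) mconst (linear_forms 0 k)" and ?L = "Lin_A_ideal 0 k J"
  have "?L +>\<^bsub>?M\<^esub> l = ?L +>\<^bsub>?M\<^esub> l' \<longleftrightarrow> (\<exists>n\<in>?L. l = n \<oplus>\<^bsub>?M\<^esub> l')"
    using assms(3,4) module.axioms(2)[OF linear_forms_module]
      submodule.axioms(1)[OF Lin_ideal_submodule_K[OF assms(1,2)]]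
    by (intro coset_eq_iff) simp_all
  also have "\<dots> \<longleftrightarrow> l - l' \<in> ?L"
    by (auto intro!: bexI[of _ "l - l'"])
  finally show ?thesis by simp
qed

text \<open>
  Two linear forms have the same class in the cotangent space iff their difference lies in
  \<open>J + \<langle>X\<rangle>\<^sup>2\<close>, that is, by part (a), in \<open>Lin(J)\<close>.  So the projections of the space of linear forms to
  both sides have the same fibres.
\<close>

lemma linear_forms_Cot_iso:
  fixes J :: "'a::field mpol set"
  assumes J: "ideal J (ring_P 0 k)" and JX: "J \<subseteq> X_ideal 0 k"
  obtains \<psi> where "\<psi> \<in> module_iso_set ring_K
      (quot_module (subset_module (ring_P 0 k) mconst (linear_forms 0 k)) (Lin_A_ideal 0 k J))
      (Cot (ring_P 0 k Quot J) (quot_const (ring_P 0 k) J)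
        (quot_ideal (ring_P 0 k) J (X_ideal 0 k)))"
    "\<And>l. l \<in> linear_forms 0 k \<Longrightarrow>
      \<psi> (Lin_A_ideal 0 k J +>\<^bsub>ring_P 0 k\<^esub> l) = Cot_class 0 k J (X_ideal 0 k) l"
proof -
  let ?L = "Lin_A_ideal 0 k J" and ?\<pi> = "Cot_class 0 k J (X_ideal 0 k)"
    and ?C = "Cot (ring_P 0 k Quot J) (quot_const (ring_P 0 k) J)
      (quot_ideal (ring_P 0 k) J (X_ideal 0 k))"
  have \<pi>: "?\<pi> \<in> module_epi_set ring_K (subset_module (ring_P 0 k) mconst (X_ideal 0 k)) ?C"
    by (rule Cot_class_epi[OF J X_ideal_ideal])
  have V: "l \<in> X_ideal 0 k" if "l \<in> linear_forms 0 k" for l :: "'a mpol"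
    using that linear_forms_le_X_ideal by blast
  have "?\<pi> ` linear_forms 0 k = carrier ?C"
  proof -
    have "?\<pi> f \<in> ?\<pi> ` linear_forms 0 k" if f: "f \<in> X_ideal 0 k" for f
      using Cot_class_xpart[OF J f] xpart_1_in_linear_forms[OF X_ideal_in_P[OF f]] by (metis imageI)
    then have "?\<pi> ` linear_forms 0 k = ?\<pi> ` X_ideal 0 k" using V by blast
    then show ?thesis using \<pi> by (simp add: module_epi_set_def)
  qed
  then have epi: "?\<pi> \<in> module_epi_set ring_K (subset_module (ring_P 0 k) mconst (linear_forms 0 k)) ?C"
    using \<pi> V unfolding module_epi_set_def module_hom_set_def by (simp add: Pi_iff)
  have ker: "?L +>\<^bsub>ring_P 0 k\<^esub> l = ?L +>\<^bsub>ring_P 0 k\<^esub> l' \<longleftrightarrow> ?\<pi> l = ?\<pi> l'"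
    if l: "l \<in> linear_forms 0 k" "l' \<in> linear_forms 0 k" for l l'
  proof -
    have "?\<pi> l = ?\<pi> l' \<longleftrightarrow> (\<exists>i\<in>J. \<exists>t\<in>X_ideal_sq 0 k. l = i + (t + l'))"
      unfolding X_ideal_sq_def using l V by (intro Cot_class_eq_iff[OF J X_ideal_ideal])
    also have "\<dots> \<longleftrightarrow> (\<exists>i\<in>J. \<exists>t\<in>X_ideal_sq 0 k. l - l' = i + t)"
      by (simp add: algebra_simps)
    also have "\<dots> \<longleftrightarrow> l - l' \<in> ?L"
      unfolding Lin_A_ideal_eq[OF J JX] A_span_X_set Int_iff set_add_P
      using linear_forms_minus[OF l] by blast
    finally show ?thesis unfolding Lin_coset_eq_iff[OF J JX l] by blast
  qed
  show ?thesis
    by (rule epi_factor_iso[OF linear_forms_module Lin_quotient_epi[OF J JX] epi])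
      (use ker that in simp_all)
qed

lemma eps_ideal:
  assumes "ideal I (ring_P m k)" shows "ideal (eps \<gamma> ` I) (ring_P 0 k)"
  by (rule ideal_hom_image[OF cring.axioms(1)[OF cring_P] eps_hom eps_surj assms])

lemma eps_le_X_ideal:
  assumes "I \<subseteq> X_ideal m k" shows "eps \<gamma> ` I \<subseteq> X_ideal 0 k"
  using assms X_ideal_le_M_Gamma0 eps_M_Gamma0 by blast

lemma xpart_1_mconst_mult: "xpart 1 (mconst c * p) = mconst c * xpart 1 p"
proof -
  have "xpart 0 (mconst c) = mconst c" "xpart 1 (mconst c) = 0"
    by (simp_all add: mconst_def xpart_simps)
  then show ?thesis unfolding xpart_1_mult by simp
qed

text \<open>
  If \<open>f\<close> and \<open>g\<close> differ by \<open>i + t\<close> with \<open>i \<in> I\<close> and \<open>t\<close> in the square of \<open>\<MM>\<^sub>\<Gamma>\<^sub>0\<close>, then the linear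
  parts of \<open>\<epsilon>\<^sub>\<Gamma>(f)\<close> and \<open>\<epsilon>\<^sub>\<Gamma>(g)\<close> differ by that of \<open>\<epsilon>\<^sub>\<Gamma>(i) \<in> I\<^sub>\<Gamma>\<close>.
\<close>

lemma Cot_eps_epi:
  fixes I :: "'a::field mpol set"
  assumes I: "ideal I (ring_P m k)" and IX: "I \<subseteq> X_ideal m k"
  obtains \<phi> where "\<phi> \<in> module_epi_set ring_K
      (Cot (ring_P m k Quot I) (quot_const (ring_P m k) I)
        (quot_ideal (ring_P m k) I (M_Gamma0 m k \<gamma>)))
      (quot_module (subset_module (ring_P 0 k) mconst (linear_forms 0 k)) (Lin_A_ideal 0 k (eps \<gamma> ` I)))"
    "\<And>f. f \<in> M_Gamma0 m k \<gamma> \<Longrightarrow> \<phi> (Cot_class m k I (M_Gamma0 m k \<gamma>) f) =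
      Lin_A_ideal 0 k (eps \<gamma> ` I) +>\<^bsub>ring_P 0 k\<^esub> xpart 1 (eps \<gamma> f)"
proof -
  let ?J = "M_Gamma0 m k \<gamma>" and ?L = "Lin_A_ideal 0 k (eps \<gamma> ` I)"
  let ?\<pi> = "Cot_class m k I ?J" and ?h = "\<lambda>f. xpart 1 (eps \<gamma> f)"
  note J = M_Gamma0_ideal[of m k \<gamma>] and I\<Gamma> = eps_ideal[OF I, of \<gamma>] and I\<Gamma>X = eps_le_X_ideal[OF IX, of \<gamma>]
  have h_lin: "?h f \<in> linear_forms 0 k" if "f \<in> ?J" for f
    using eps_closed[OF ideal.Icarr[OF J that]] by (rule xpart_1_in_linear_forms)
  have h: "?h \<in> module_epi_set ring_K (subset_module (ring_P m k) mconst ?J)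
      (subset_module (ring_P 0 k) mconst (linear_forms 0 k))"
  proof -
    have "l \<in> ?h ` ?J" if l: "l \<in> linear_forms 0 k" for l :: "'a mpol"
    proof -
      obtain f where f: "f \<in> ?J" "l = eps \<gamma> f"
        using l linear_forms_le_X_ideal eps_M_Gamma0[of \<gamma> m k] by blast
      have "l = ?h f" unfolding f(2)[symmetric] by (rule xpart_linear_forms[OF l, symmetric])
      then show ?thesis using f(1) by blast
    qed
    moreover have "?h (x + y) = ?h x + ?h y" for x y
      unfolding eps_add xpart_simps ..
    moreover have "?h (mconst c * x) = mconst c * ?h x" for c x
      unfolding eps_mult eps_mconst xpart_1_mconst_mult ..
    ultimately show ?thesis
      using h_lin unfolding module_epi_set_def module_hom_set_def by auto
  qed
  have ker: "?L +>\<^bsub>ring_P 0 k\<^esub> ?h f = ?L +>\<^bsub>ring_P 0 k\<^esub> ?h g"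
    if fg: "f \<in> ?J" "g \<in> ?J" and eq: "?\<pi> f = ?\<pi> g" for f g
  proof -
    obtain i t where it: "i \<in> I" "t \<in> ideal_prod (ring_P m k) ?J ?J" "f = i + (t + g)"
      using eq Cot_class_eq_iff[OF I J fg] by blast
    have "eps \<gamma> t \<in> X_ideal_sq 0 k" using it(2) eps_M_Gamma0_sq by blast
    then have "?h f - ?h g = xpart 1 (eps \<gamma> i)"
      unfolding it(3) eps_add xpart_simps by (simp only: xpart_1_X_ideal_sq) simp
    also have "\<dots> = Lin_A 0 k (eps \<gamma> i)"
      using ideal.Icarr[OF I\<Gamma>, of "eps \<gamma> i"] it(1) by (intro Lin_A_eq[symmetric]) blast
    also have "\<dots> \<in> ?L"
      unfolding Lin_A_ideal_def using it(1) by (intro subsetD[OF A_span_superset]) blast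
    finally show ?thesis
      by (subst Lin_coset_eq_iff[OF I\<Gamma> I\<Gamma>X h_lin[OF fg(1)] h_lin[OF fg(2)]])
  qed
  have mod: "module ring_K (subset_module (ring_P m k) mconst ?J)"
    by (rule module_on_submodule[OF cring_ring_K cring_P mconst_hom_P])
      (rule ideal_is_submodule[OF cring_ring_K cring_P mconst_hom_P J])
  show ?thesis
    by (rule epi_factor[OF mod Cot_class_epi[OF I J]
          module_epi_set_comp[OF h Lin_quotient_epi[OF I\<Gamma> I\<Gamma>X]]],
        unfold subset_module_simps) (erule ker, assumption, assumption, erule that)
qed

theorem proposition5p4:
  fixes m k :: nat and w :: "nat \<Rightarrow> nat"
    and I G :: "'a::field mpol set"
    and \<gamma> :: "nat \<Rightarrow> 'a"
  assumes "positive_algebra m k w I"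
    and "finite G" and "G \<subseteq> carrier (ring_P m k)" and "I = Idl\<^bsub>ring_P m k\<^esub> G"
  shows
    "Lin_A_ideal m k I = A_span m k (X_set k) \<inter> (I <+>\<^bsub>ring_P m k\<^esub> X_ideal_sq m k) \<and>
     Lin_A_ideal m k I = A_span m k (Lin_A m k ` G) \<and>
     (let P = ring_P m k; KX = ring_KX k; I\<^sub>\<Gamma> = eps \<gamma> ` I;
          R = P Quot I; \<MM> = quot_ideal P I (M_Gamma0 m k \<gamma>);
          S = KX Quot I\<^sub>\<Gamma>; \<NN> = quot_ideal KX I\<^sub>\<Gamma> (Idl\<^bsub>KX\<^esub> (X_set k));
          CotR = Cot R (quot_const P I) \<MM>;
          CotS = Cot S (quot_const KX I\<^sub>\<Gamma>) \<NN>;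
          V = K_span k (X_set k); L = Lin_X k I\<^sub>\<Gamma>;
          VL = quot_module (subset_module KX mconst V) L
      in \<exists>\<phi> \<psi>.
        \<phi> \<in> module_epi_set ring_K CotR VL \<and>
        \<psi> \<in> module_iso_set ring_K VL CotS \<and>
        (\<forall>l\<in>V. \<psi> (L +>\<^bsub>KX\<^esub> l) = ideal_prod S \<NN> \<NN> +>\<^bsub>S\<^esub> (I\<^sub>\<Gamma> +>\<^bsub>KX\<^esub> l)) \<and>
        (\<forall>f\<in>M_Gamma0 m k \<gamma>.
           \<psi> (\<phi> (ideal_prod R \<MM> \<MM> +>\<^bsub>R\<^esub> (I +>\<^bsub>P\<^esub> f))) =
             ideal_prod S \<NN> \<NN> +>\<^bsub>S\<^esub> (I\<^sub>\<Gamma> +>\<^bsub>KX\<^esub> eps \<gamma> f)))"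
proof -
  have I: "ideal I (ring_P m k)" using assms(1) by (simp add: positive_algebra_def)
  have IX: "I \<subseteq> X_ideal m k" by (rule positive_algebra_le_X_ideal[OF assms(1)])
  have "G \<subseteq> I" unfolding assms(4) genideal_def by blast
  then have GX: "G \<subseteq> X_ideal m k" using IX by blast
  note I\<Gamma> = eps_ideal[OF I, of \<gamma>] and I\<Gamma>X = eps_le_X_ideal[OF IX, of \<gamma>]
  have L: "Lin_X k (eps \<gamma> ` I) = Lin_A_ideal 0 k (eps \<gamma> ` I)"
    using I\<Gamma>X X_ideal_in_P by (intro Lin_X_eq) blast
  obtain \<psi> where \<psi>: "\<psi> \<in> module_iso_set ring_K
      (quot_module (subset_module (ring_P 0 k) mconst (linear_forms 0 k)) (Lin_A_ideal 0 k (eps \<gamma> ` I)))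
      (Cot (ring_P 0 k Quot (eps \<gamma> ` I)) (quot_const (ring_P 0 k) (eps \<gamma> ` I))
        (quot_ideal (ring_P 0 k) (eps \<gamma> ` I) (X_ideal 0 k)))"
    "\<And>l. l \<in> linear_forms 0 k \<Longrightarrow> \<psi> (Lin_A_ideal 0 k (eps \<gamma> ` I) +>\<^bsub>ring_P 0 k\<^esub> l) =
      Cot_class 0 k (eps \<gamma> ` I) (X_ideal 0 k) l"
    by (rule linear_forms_Cot_iso[OF I\<Gamma> I\<Gamma>X]) blast
  obtain \<phi> where \<phi>: "\<phi> \<in> module_epi_set ring_K
      (Cot (ring_P m k Quot I) (quot_const (ring_P m k) I)
        (quot_ideal (ring_P m k) I (M_Gamma0 m k \<gamma>)))
      (quot_module (subset_module (ring_P 0 k) mconst (linear_forms 0 k)) (Lin_A_ideal 0 k (eps \<gamma> ` I)))"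
    "\<And>f. f \<in> M_Gamma0 m k \<gamma> \<Longrightarrow> \<phi> (Cot_class m k I (M_Gamma0 m k \<gamma>) f) =
      Lin_A_ideal 0 k (eps \<gamma> ` I) +>\<^bsub>ring_P 0 k\<^esub> xpart 1 (eps \<gamma> f)"
    by (rule Cot_eps_epi[OF I IX]) blast
  have "\<psi> (\<phi> (Cot_class m k I (M_Gamma0 m k \<gamma>) f)) =
      Cot_class 0 k (eps \<gamma> ` I) (X_ideal 0 k) (eps \<gamma> f)" if f: "f \<in> M_Gamma0 m k \<gamma>" for f
  proof -
    have X: "eps \<gamma> f \<in> X_ideal 0 k" using f eps_M_Gamma0 by blast
    show ?thesis
      unfolding \<phi>(2)[OF f] Cot_class_xpart[OF I\<Gamma> X]
      by (rule \<psi>(2)[OF xpart_1_in_linear_forms[OF X_ideal_in_P[OF X]]])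
  qed
  then show ?thesis
    using Lin_A_ideal_eq[OF I IX] Lin_A_ideal_generators[OF GX] \<phi>(1) \<psi>
    unfolding Let_def ring_KX_eq K_span_eq A_span_X_set L X_ideal_def[of 0 k, symmetric]
      assms(4)[symmetric] Cot_class_def
    by blast
qed

end
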